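(* Let $p$ be a prime and let $a\in\mathbb{F}_p((x))$ be a Laurent series that is algebraic over $\mathbb{F}_p(x)$. Assume that the first order differential equation $y'=ay$ is regular at $0$ and has local exponent $\rho=0$. Then there exists a non-zero solution $y\in\mathbb{F}_p[z_1,z_2,\ldots][[x]]$ of $y'=ay$ such that for every $i\ge1$ the projection $y|_{z_{i+1}=z_{i+2}=\cdots=0}$ is algebraic over $\mathbb{F}_p(x,z_1,\ldots,z_i)$, and such that $y$ can be written as an infinite product \[ y=\prod_{i=0}^\infty h_i, \] where for every $i\ge 0$ the factor $h_i$ belongs to $1+x^{p^i}z_i\,\mathbb{F}_p[z_1,z_2,\ldots,z_i][[x]]$ (with $z_0:=1$) and is algebraic over $\mathbb{F}_p(x,z_1,\ldots,z_i)$.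
   Context: $\mathcal{R}_p=\mathbb{F}_p(z_1,z_2,\ldots)((x))$ is the field of formal Laurent series in $x$ whose coefficients are rational functions over $\mathbb{F}_p$ in countably many variables $z_1,z_2,\ldots$ (each single coefficient involves only finitely many of them). It carries the $\mathbb{F}_p$-derivation $\partial$ (also written $y\mapsto y'$), acting termwise on series in $x$, with $\partial x=1$, $\partial z_1=\frac1x$ and $\partial z_i=\frac{1}{x z_1\cdots z_{i-1}}$ for $i\ge2$. Solutions are understood in $\mathcal{R}_p$, which contains the ring $\mathbb{F}_p[z_1,z_2,\ldots][[x]]$ of power series in $x$ with coefficients polynomials in the $z_i$. The projection $y|_{z_{i+1}=z_{i+2}=\cdots=0}$ is obtained by setting $z_j=0$ for all $j>i$ in every coefficient. Infinite products converge in the $x$-adic topology. The equation $y'=ay$ is regular (has a regular singularity) at $0$ if $a$ has a pole of order at most $1$ at $0$; its local exponent is then the coefficient of $x^{-1}$ in $a$. *)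

theory Defs
  imports
    "Berlekamp_Zassenhaus.Finite_Field"
    "HOL-Library.Poly_Mapping"
    "HOL-Computational_Algebra.Polynomial_Factorial"
    "HOL-Computational_Algebra.Formal_Laurent_Series"
begin

section \<open>Polynomials in countably many variables\<close>

text \<open>
  \<open>'k zpoly\<close> is $k[z_1,z_2,\ldots]$: a monomial is a finitely supported exponent function
  \<open>nat \<Rightarrow>\<^sub>0 nat\<close>, whose entry at position \<open>j\<close> is the exponent of $z_{j+1}$. The shift makes room
  for the convention $z_0 = 1$, which is built into the function \<open>z\<close> below.
  The library's metric topology on \<open>'k zpoly fps\<close> is the $x$-adic one.
\<close>

type_synonym 'k zpoly = "(nat \<Rightarrow>\<^sub>0 nat) \<Rightarrow>\<^sub>0 'k"

definition zconst :: "'k::zero \<Rightarrow> 'k zpoly" where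
  "zconst c = Poly_Mapping.single 0 c"

definition z :: "nat \<Rightarrow> 'k::comm_ring_1 zpoly" where
  "z i = (if i = 0 then 1 else Poly_Mapping.single (Poly_Mapping.single (i - 1) 1) 1)"

text \<open>The positions (that is, indices minus one) of the variables that occur in a polynomial.\<close>

definition zpositions :: "'k::zero zpoly \<Rightarrow> nat set" where
  "zpositions f = (\<Union>m\<in>Poly_Mapping.keys f. Poly_Mapping.keys m)"

text \<open>The subring $k[z_1,\ldots,z_i]$.\<close>

definition zpolys_upto :: "nat \<Rightarrow> 'k::zero zpoly set" where
  "zpolys_upto i = {f. zpositions f \<subseteq> {..<i}}"

text \<open>The value of \<open>f\<close> under the substitution $z_j \mapsto s\,j$, for all $j \ge 1$.\<close>

definition zsubst :: "(nat \<Rightarrow> 'k zpoly) \<Rightarrow> 'k::comm_ring_1 zpoly \<Rightarrow> 'k zpoly" where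
  "zsubst s f = (\<Sum>m\<in>Poly_Mapping.keys f. zconst (Poly_Mapping.lookup f m) *
     (\<Prod>j\<in>Poly_Mapping.keys m. s (Suc j) ^ Poly_Mapping.lookup m j))"

text \<open>The projection $y|_{z_{i+1}=z_{i+2}=\cdots=0}$, applied to every coefficient of \<open>y\<close>.\<close>

definition zproj :: "nat \<Rightarrow> 'k::comm_ring_1 zpoly fps \<Rightarrow> 'k zpoly fps" where
  "zproj i y = Abs_fps (\<lambda>n. zsubst (\<lambda>j. if j \<le> i then z j else 0) (fps_nth y n))"


section \<open>The differential field of Laurent series over the rational functions in the z's\<close>

type_synonym 'k zfrac = "'k zpoly fract"
type_synonym 'k zlaurent = "'k zfrac fls"

text \<open>Partial derivative with respect to $z_{j+1}$.\<close>

definition zpderiv :: "nat \<Rightarrow> 'k::comm_ring_1 zpoly \<Rightarrow> 'k zpoly" where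
  "zpderiv j f = (\<Sum>m\<in>Poly_Mapping.keys f.
     Poly_Mapping.single (m - Poly_Mapping.single j 1)
       (of_nat (Poly_Mapping.lookup m j) * Poly_Mapping.lookup f m))"

text \<open>
  On $k(z_1,z_2,\ldots)$ the derivation of the Laurent series field has the form $x^{-1} D$,
  where $D$ is the $k$-derivation with $D z_i = 1/(z_1 \cdots z_{i-1})$. The empty
  product covers $z_1$. We first define $D$ on polynomials by the chain rule, then extend
  it to fractions by the quotient rule; the result does not depend on the representation
  of the fraction (lemma \<open>zfrac_deriv_Fract\<close>).
\<close>

definition zpoly_deriv :: "'k::field zpoly \<Rightarrow> 'k zfrac" where
  "zpoly_deriv f = (\<Sum>j\<in>zpositions f. to_fract (zpderiv j f) / to_fract (\<Prod>k=1..j. z k))"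

definition zfrac_deriv :: "'k::field zfrac \<Rightarrow> 'k zfrac" where
  "zfrac_deriv q = (THE r. \<forall>a b. b \<noteq> 0 \<and> q = Fract a b \<longrightarrow>
     r = (zpoly_deriv a * to_fract b - to_fract a * zpoly_deriv b) / to_fract b ^ 2)"

definition fls_map :: "('a::zero \<Rightarrow> 'b::zero) \<Rightarrow> 'a fls \<Rightarrow> 'b fls" where
  "fls_map g f = Abs_fls (\<lambda>n. g (fls_nth f n))"

text \<open>
  Termwise, $\partial (c\,x^n) = x^{-1} D(c)\,x^n + n\,c\,x^{n-1}$.
\<close>

definition zlaurent_deriv :: "'k::field zlaurent \<Rightarrow> 'k zlaurent" where
  "zlaurent_deriv f = fls_X_inv * fls_map zfrac_deriv f + fls_deriv f"

text \<open>The inclusions of $k((x))$ and of $k[z_1,z_2,\ldots][[x]]$.\<close>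

definition embed_fls :: "'k::field fls \<Rightarrow> 'k zlaurent" where
  "embed_fls a = fls_map (\<lambda>c. to_fract (zconst c)) a"

definition embed_fps :: "'k::field zpoly fps \<Rightarrow> 'k zlaurent" where
  "embed_fps y = fps_to_fls (Abs_fps (\<lambda>n. to_fract (fps_nth y n)))"


section \<open>Algebraic elements\<close>

definition is_subfield :: "'a::field set \<Rightarrow> bool" where
  "is_subfield K \<longleftrightarrow> 1 \<in> K \<and> (\<forall>a\<in>K. \<forall>b\<in>K. a - b \<in> K \<and> a * b \<in> K) \<and> (\<forall>a\<in>K. inverse a \<in> K)"

definition algebraic_over :: "'a::field set \<Rightarrow> 'a \<Rightarrow> bool" where
  "algebraic_over K a \<longleftrightarrow> (\<exists>P. P \<noteq> 0 \<and> (\<forall>n. Polynomial.coeff P n \<in> K) \<and> poly P a = 0)"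

text \<open>The subfield $k(x)$ of $k((x))$.\<close>

definition rat_funs :: "'k::field fls set" where
  "rat_funs = is_subfield hull (range fls_const \<union> {fls_X})"

text \<open>The subfield $k(x,z_1,\ldots,z_i)$ of $k(z_1,z_2,\ldots)((x))$.\<close>

definition zrat_funs :: "nat \<Rightarrow> 'k::field zlaurent set" where
  "zrat_funs i = is_subfield hull
     (range (\<lambda>c. fls_const (to_fract (zconst c))) \<union> {fls_X} \<union>
      (\<lambda>j. fls_const (to_fract (z j))) ` {1..i})"


section \<open>Regularity and local exponent of \<open>y' = a y\<close> at 0\<close>

definition regular_at_0 :: "'k::field fls \<Rightarrow> bool" where
  "regular_at_0 a \<longleftrightarrow> fls_subdegree a \<ge> -1"

definition local_exponent :: "'k::field fls \<Rightarrow> 'k" where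
  "local_exponent a = fls_nth a (-1)"


section \<open>The derivation is well defined\<close>

lemma fls_map_nth:
  assumes "g 0 = 0"
  shows "fls_nth (fls_map g f) n = g (fls_nth f n)"
proof -
  obtain N where N: "\<forall>n<N. fls_nth f n = 0" by (rule fls_nth_vanishes_belowE)
  then have "\<forall>n<N. g (fls_nth f n) = 0" using assms by simp
  then show ?thesis unfolding fls_map_def by (rule nth_Abs_fls_lower_bound)
qed

lemma fls_map_const: "g 0 = 0 \<Longrightarrow> fls_map g (fls_const c) = fls_const (g c)"
  by (intro fls_eqI) (simp add: fls_map_nth)

lemma zpoly_induct [case_names zero add]:
  fixes f :: "'k::comm_ring_1 zpoly"
  assumes "P 0" and "\<And>f m c. P f \<Longrightarrow> P (f + Poly_Mapping.single m c)"
  shows "P f"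
proof (induction f rule: update_induct)
  case const
  then show ?case using assms(1) by simp
next
  case (update f k v)
  have "Poly_Mapping.update k v f = f + Poly_Mapping.single k v"
    using update(1) by (intro poly_mapping_eqI)
      (auto simp: lookup_update lookup_add lookup_single when_def in_keys_iff)
  then show ?case using assms(2) update by metis
qed

lemma zpderiv_superset:
  assumes "finite S" "Poly_Mapping.keys f \<subseteq> S"
  shows "zpderiv j f = (\<Sum>m\<in>S. Poly_Mapping.single (m - Poly_Mapping.single j 1)
       (of_nat (Poly_Mapping.lookup m j) * Poly_Mapping.lookup f m))"
  unfolding zpderiv_def using assms by (intro sum.mono_neutral_left) (auto simp: in_keys_iff)

lemma zpderiv_zero [simp]: "zpderiv j 0 = 0"
  by (simp add: zpderiv_def)

lemma zpderiv_add: "zpderiv j (f + g) = zpderiv j f + zpderiv j g"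
proof -
  let ?S = "Poly_Mapping.keys f \<union> Poly_Mapping.keys g"
  have "Poly_Mapping.keys (f + g) \<subseteq> ?S" by (rule Poly_Mapping.keys_add)
  then show ?thesis
    by (subst (1 2 3) zpderiv_superset[of ?S])
       (auto simp: lookup_add distrib_left single_add sum.distrib)
qed

lemma zpderiv_single:
  "zpderiv j (Poly_Mapping.single m c) =
     Poly_Mapping.single (m - Poly_Mapping.single j 1) (of_nat (Poly_Mapping.lookup m j) * c)"
  by (subst zpderiv_superset[of "{m}"]) auto

lemma monomial_minus_add:
  fixes m n :: "nat \<Rightarrow>\<^sub>0 nat"
  assumes "Poly_Mapping.lookup m j \<noteq> 0"
  shows "m + n - Poly_Mapping.single j 1 = (m - Poly_Mapping.single j 1) + n"
  using assms by (intro poly_mapping_eqI) (auto simp: lookup_add lookup_minus lookup_single when_def)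

lemma zpderiv_mult_single:
  "zpderiv j (Poly_Mapping.single m c * Poly_Mapping.single n d) =
     zpderiv j (Poly_Mapping.single m c) * Poly_Mapping.single n d +
     Poly_Mapping.single m c * zpderiv j (Poly_Mapping.single n d)"
proof (cases "Poly_Mapping.lookup m j = 0"; cases "Poly_Mapping.lookup n j = 0")
  assume "Poly_Mapping.lookup m j \<noteq> 0" "Poly_Mapping.lookup n j \<noteq> 0"
  then show ?thesis
    using monomial_minus_add[of m j n] monomial_minus_add[of n j m]
    by (simp add: zpderiv_single mult_single lookup_add single_add[symmetric] algebra_simps)
next
  assume "Poly_Mapping.lookup m j \<noteq> 0" "Poly_Mapping.lookup n j = 0"
  then show ?thesis
    using monomial_minus_add[of m j n]
    by (simp add: zpderiv_single mult_single lookup_add algebra_simps)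
next
  assume "Poly_Mapping.lookup m j = 0" "Poly_Mapping.lookup n j \<noteq> 0"
  then show ?thesis
    using monomial_minus_add[of n j m]
    by (simp add: zpderiv_single mult_single lookup_add algebra_simps)
next
  assume "Poly_Mapping.lookup m j = 0" "Poly_Mapping.lookup n j = 0"
  then show ?thesis
    by (simp add: zpderiv_single mult_single lookup_add)
qed

lemma zpderiv_mult: "zpderiv j (f * g) = zpderiv j f * g + f * zpderiv j g"
proof (induction f rule: zpoly_induct)
  case (add f m c)
  have "zpderiv j (Poly_Mapping.single m c * g) =
      zpderiv j (Poly_Mapping.single m c) * g + Poly_Mapping.single m c * zpderiv j g"
    by (induction g rule: zpoly_induct)
       (simp_all add: zpderiv_add zpderiv_mult_single algebra_simps)
  with add show ?case by (simp add: zpderiv_add algebra_simps)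
qed simp

lemma finite_zpositions: "finite (zpositions f)"
  by (simp add: zpositions_def)

lemma zpderiv_eq_0: "j \<notin> zpositions f \<Longrightarrow> zpderiv j f = 0"
  by (auto simp: zpderiv_def zpositions_def in_keys_iff intro!: sum.neutral)

lemma zpoly_deriv_superset:
  assumes "finite S" "zpositions f \<subseteq> S"
  shows "zpoly_deriv f = (\<Sum>j\<in>S. to_fract (zpderiv j f) / to_fract (\<Prod>k=1..j. z k))"
  unfolding zpoly_deriv_def using assms
  by (intro sum.mono_neutral_left) (auto simp: zpderiv_eq_0)

lemma zpoly_deriv_add: "zpoly_deriv (f + g) = zpoly_deriv f + zpoly_deriv g"
proof -
  let ?S = "zpositions f \<union> zpositions g \<union> zpositions (f + g)"
  show ?thesis
    by (subst (1 2 3) zpoly_deriv_superset[of ?S])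
       (auto simp: finite_zpositions zpderiv_add sum.distrib add_divide_distrib)
qed

lemma zpoly_deriv_mult:
  "zpoly_deriv (f * g) = zpoly_deriv f * to_fract g + to_fract f * zpoly_deriv g"
proof -
  let ?S = "zpositions f \<union> zpositions g \<union> zpositions (f * g)"
  show ?thesis
    by (subst (1 2 3) zpoly_deriv_superset[of ?S])
       (auto simp: finite_zpositions zpderiv_mult sum.distrib add_divide_distrib
          sum_distrib_left sum_distrib_right mult.commute)
qed

lemma zpoly_deriv_const [simp]: "zpoly_deriv (zconst c) = 0"
  by (auto simp: zpoly_deriv_def zconst_def zpositions_def split: if_splits)

lemma zpoly_deriv_1 [simp]: "zpoly_deriv 1 = 0"
  using zpoly_deriv_const[of 1] by (simp add: zconst_def)

lemma zpoly_deriv_z: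
  assumes "i \<ge> 1"
  shows "zpoly_deriv (z i) = 1 / to_fract (\<Prod>k=1..i-1. z k)"
proof -
  have "zpoly_deriv (z i) = (\<Sum>j\<in>{i - 1}. to_fract (zpderiv j (z i)) / to_fract (\<Prod>k=1..j. z k))"
    using assms by (intro zpoly_deriv_superset) (auto simp: z_def zpositions_def split: if_splits)
  then show ?thesis using assms by (simp add: z_def zpderiv_single)
qed

lemma zfrac_deriv_Fract:
  assumes "b \<noteq> 0"
  shows "zfrac_deriv (Fract a b) =
    (zpoly_deriv a * to_fract b - to_fract a * zpoly_deriv b) / to_fract b ^ 2"
proof -
  let ?r = "\<lambda>a b. (zpoly_deriv a * to_fract b - to_fract a * zpoly_deriv b) / to_fract b ^ 2"
  have "?r a b = ?r c d" if "d \<noteq> 0" "Fract a b = Fract c d" for c d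
  proof -
    have eq: "a * d = c * b" using that assms by (simp add: eq_fract)
    have D: "zpoly_deriv a * to_fract d + to_fract a * zpoly_deriv d =
             zpoly_deriv c * to_fract b + to_fract c * zpoly_deriv b"
      using arg_cong[OF eq, of zpoly_deriv] by (simp add: zpoly_deriv_mult)
    have E: "to_fract a * to_fract d = to_fract c * to_fract b"
      using arg_cong[OF eq, of to_fract] by simp
    have nz: "to_fract b \<noteq> 0" "to_fract d \<noteq> 0" using assms that by simp_all
    have "(A * B - A0 * B') * C ^ 2 = (C0' * C - C0 * C') * B ^ 2"
      if "A * C + A0 * C' = C0' * B + C0 * B'" "A0 * C = C0 * B"
      for A A0 B B' C C' C0 C0' :: "'a zfrac"
    proof -
      have "A * C = C0' * B + C0 * B' - A0 * C'"
        using that(1) by (simp add: algebra_simps)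
      then have "(A * B - A0 * B') * C ^ 2 =
          (C0' * B + C0 * B' - A0 * C') * (B * C) - (A0 * C) * B' * C"
        by (metis (no_types, opaque_lifting) left_diff_distrib mult.assoc mult.commute power2_eq_square)
      also have "\<dots> = C0' * C * B ^ 2 - (A0 * C) * C' * B + (C0 * B) * B' * C - (A0 * C) * B' * C"
        by (simp add: algebra_simps power2_eq_square)
      finally show ?thesis
        unfolding that(2) by (simp add: algebra_simps power2_eq_square)
    qed
    from this[OF D E] show ?thesis using nz by (simp add: frac_eq_eq)
  qed
  then show ?thesis
    unfolding zfrac_deriv_def using assms by (intro the_equality) blast+
qed

lemma zfrac_deriv_to_fract: "zfrac_deriv (to_fract f) = zpoly_deriv f"
  using zfrac_deriv_Fract[of 1 f] by (simp add: to_fract_def[symmetric])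

lemma zfrac_deriv_0 [simp]: "zfrac_deriv 0 = 0"
  using zfrac_deriv_to_fract[of 0] by (simp add: zpoly_deriv_def zpositions_def)

lemma zfrac_deriv_1 [simp]: "zfrac_deriv 1 = 0"
  using zfrac_deriv_to_fract[of 1] by simp

lemma Fract_eq_divide: "b \<noteq> 0 \<Longrightarrow> Fract a b = to_fract a / to_fract b"
  by (simp add: to_fract_def divide_fract_def)

lemma zfrac_deriv_add: "zfrac_deriv (q + r) = zfrac_deriv q + zfrac_deriv r"
proof (cases q; cases r)
  fix a b c d :: "'a zpoly"
  assume *: "q = Fract a b" "b \<noteq> 0" "r = Fract c d" "d \<noteq> 0"
  then have "to_fract b \<noteq> 0" "to_fract d \<noteq> 0" by simp_all
  with * show ?thesis
    by (simp add: zfrac_deriv_Fract zpoly_deriv_add zpoly_deriv_mult divide_simps)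
       (simp add: algebra_simps power2_eq_square)
qed

lemma zfrac_deriv_mult: "zfrac_deriv (q * r) = zfrac_deriv q * r + q * zfrac_deriv r"
proof (cases q; cases r)
  fix a b c d :: "'a zpoly"
  assume *: "q = Fract a b" "b \<noteq> 0" "r = Fract c d" "d \<noteq> 0"
  then have "to_fract b \<noteq> 0" "to_fract d \<noteq> 0" by simp_all
  with * show ?thesis
    by (simp add: zfrac_deriv_Fract zpoly_deriv_mult)
       (simp add: Fract_eq_divide field_simps power2_eq_square)
qed

lemma zlaurent_deriv_nth:
  "fls_nth (zlaurent_deriv f) n =
     zfrac_deriv (fls_nth f (n + 1)) + of_int (n + 1) * fls_nth f (n + 1)"
  by (simp add: zlaurent_deriv_def fls_X_inv_times_conv_shift fls_map_nth)

lemma zlaurent_deriv_add: "zlaurent_deriv (f + g) = zlaurent_deriv f + zlaurent_deriv g"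
  by (intro fls_eqI) (simp add: zlaurent_deriv_nth zfrac_deriv_add algebra_simps)

lemma zfrac_deriv_sum: "zfrac_deriv (sum g A) = (\<Sum>a\<in>A. zfrac_deriv (g a))"
  by (induction A rule: infinite_finite_induct) (simp_all add: zfrac_deriv_add)

lemma fls_times_nth_bounded:
  fixes f g :: "'a::comm_ring_1 fls"
  assumes "\<forall>n<N. fls_nth f n = 0" "\<forall>n<M. fls_nth g n = 0"
  shows "fls_nth (f * g) n = (\<Sum>i=N..n - M. fls_nth f i * fls_nth g (n - i))"
proof (cases "f = 0 \<or> g = 0")
  case False
  then have "N \<le> fls_subdegree f" "M \<le> fls_subdegree g"
    using assms by (metis nth_fls_subdegree_nonzero not_less)+
  then show ?thesis
    unfolding fls_times_nth(2)
    by (intro sum.mono_neutral_left) (auto simp: fls_eq0_below_subdegree)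
qed auto

lemma zlaurent_deriv_mult:
  "zlaurent_deriv (f * g) = zlaurent_deriv f * g + f * zlaurent_deriv g"
proof -
  obtain N where N: "\<forall>n<N. fls_nth f n = 0" by (rule fls_nth_vanishes_belowE)
  obtain M where M: "\<forall>n<M. fls_nth g n = 0" by (rule fls_nth_vanishes_belowE)
  have N': "\<forall>n<N. fls_nth (fls_map zfrac_deriv f) n = 0" using N by (simp add: fls_map_nth)
  have M': "\<forall>n<M. fls_nth (fls_map zfrac_deriv g) n = 0" using M by (simp add: fls_map_nth)
  have "fls_map zfrac_deriv (f * g) = fls_map zfrac_deriv f * g + f * fls_map zfrac_deriv g"
    by (intro fls_eqI)
       (simp add: fls_map_nth fls_times_nth_bounded[OF N M] fls_times_nth_bounded[OF N' M]
          fls_times_nth_bounded[OF N M'] zfrac_deriv_sum zfrac_deriv_mult sum.distrib)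
  then show ?thesis by (simp add: zlaurent_deriv_def algebra_simps)
qed

lemma zlaurent_deriv_const [simp]: "zlaurent_deriv (fls_const (to_fract (zconst c))) = 0"
  by (simp add: zlaurent_deriv_def fls_map_const zfrac_deriv_to_fract)

lemma zlaurent_deriv_X [simp]: "zlaurent_deriv fls_X = 1"
  by (intro fls_eqI) (auto simp: zlaurent_deriv_nth)

lemma zlaurent_deriv_z:
  assumes "i \<ge> 1"
  shows "zlaurent_deriv (fls_const (to_fract (z i))) =
    1 / (fls_X * fls_const (to_fract (\<Prod>k=1..i-1. z k)))"
proof -
  have "zlaurent_deriv (fls_const (to_fract (z i))) =
      fls_X_inv * fls_const (1 / to_fract (\<Prod>k=1..i-1. z k))"
    using assms by (simp add: zlaurent_deriv_def fls_map_const zfrac_deriv_to_fract zpoly_deriv_z)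
  also have "\<dots> = 1 / (fls_X * fls_const (to_fract (\<Prod>k=1..i-1. z k)))"
    by (simp add: divide_inverse fls_inverse_const fls_inverse_X)
  finally show ?thesis .
qed

end

theory Submission
  imports Defs "HOL-Algebra.Finite_Extensions" "HOL-Algebra.Algebraic_Closure_Type"
begin

text \<open>
  Write $\theta = x\partial$ and $\alpha = x a$; the hypotheses say that $\alpha$ is an
  algebraic power series without constant term, and the equation becomes
  $\theta y = \alpha y$. The obstruction to solving it in $\mathbb{F}_p((x))$ is that
  $x^n$ is not in the image of $\theta$ when $p \mid n$, and that there is no exponential function.
  The variables repair this one step at a time: $z_1, z_2, \ldots$ behave like
  $\log x, \log\log x, \ldots$, with $\theta z_{i+1} = 1/(z_1\cdots z_i)$.

  The factor $h_0$ solves the equation up to $p$-th powers: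
  $\theta h_0 = (\alpha - c_0) h_0$ with $c_0 \in x^p\mathbb{F}_p[[x^p]]$. A formal solution
  pair of this kind is found by comparing coefficients. Jacobson's formula for logarithmic
  derivatives makes $\beta = \alpha - c_0$ a root of $\beta - \beta^p = \theta^{p-1}\alpha$, so
  $c_0$ is algebraic. The formal solution is multiplied by a $\theta$-constant such that the product
  becomes a differential polynomial in $\beta$, hence algebraic too (lemma
  \<open>exists_algebraic_solution_up_to_p_powers\<close>). This uses that the algebraic series are closed
  under differentiation (lemma \<open>algebraic_over_fls_deriv\<close>), which in characteristic $p$ holds
  because $\mathbb{F}_p((x))$ is separable over $\mathbb{F}_p(x)$.

  What remains is $\theta y = c_0 y$ with a $\theta$-constant $c_0$. The missing solution
  $\exp(c_0 z_1)$ is replaced as follows. Let $G$ be the power series with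
  $G - G^p = c_0 z_1$, and let
  \[ E(G) = \prod_{j=1}^{p-1} (1 - jG)^{j^{p-2}}, \qquad
     \frac{E'(G)}{E(G)} = \frac{1}{1 - G^{p-1}} . \]
  Since $\theta G = \theta(c_0 z_1) = c_0$, the factor $h_1 = E(G)$ satisfies
  \[ \frac{\theta h_1}{h_1} = \frac{c_0}{1 - G^{p-1}} = \frac{G}{z_1} = c_0 + \frac{G^p}{z_1}
     = c_0 - c_1\,\theta z_2, \qquad c_1 = -G^p . \]
  The error is again a $\theta$-constant $c_1$ times the derivative of the next variable, and the
  construction repeats (lemma \<open>euler_tower_factor\<close>). Because $c_i$ is divisible by
  $x^{p^{i+1}}$, the errors and the factors $h_i - 1$ tend to zero $x$-adically, so the infinite
  product is a solution. Every $h_i$ with $i \ge 1$ is a polynomial in a root of an Artin-Schreier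
  equation over algebraic series, hence algebraic. Setting $z_{i+1} = z_{i+2} = \cdots = 0$ turns
  the later factors into $1$ and fixes the earlier ones, so the projection of $y$ is a finite
  product of algebraic factors.
\<close>

section \<open>Subfields and algebraic elements\<close>

lemma is_subfield_add: "is_subfield K \<Longrightarrow> a \<in> K \<Longrightarrow> b \<in> K \<Longrightarrow> a + b \<in> K"
proof -
  assume K: "is_subfield K" and a: "a \<in> K" and b: "b \<in> K"
  have "0 \<in> K" using K unfolding is_subfield_def by (metis diff_self)
  then have "0 - b \<in> K" using K b unfolding is_subfield_def by blast
  then have "a - (0 - b) \<in> K" using K a unfolding is_subfield_def by blast
  then show ?thesis by simp
qed

lemma is_subfield_0: "is_subfield K \<Longrightarrow> 0 \<in> K"
  and is_subfield_1: "is_subfield K \<Longrightarrow> 1 \<in> K"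
  and is_subfield_diff: "is_subfield K \<Longrightarrow> a \<in> K \<Longrightarrow> b \<in> K \<Longrightarrow> a - b \<in> K"
  and is_subfield_mult: "is_subfield K \<Longrightarrow> a \<in> K \<Longrightarrow> b \<in> K \<Longrightarrow> a * b \<in> K"
  and is_subfield_inverse: "is_subfield K \<Longrightarrow> a \<in> K \<Longrightarrow> inverse a \<in> K"
  unfolding is_subfield_def by (metis diff_self)+

lemma is_subfield_uminus: "is_subfield K \<Longrightarrow> a \<in> K \<Longrightarrow> - a \<in> K"
  using is_subfield_diff[OF _ is_subfield_0] by fastforce

lemma is_subfield_divide: "is_subfield K \<Longrightarrow> a \<in> K \<Longrightarrow> b \<in> K \<Longrightarrow> a / b \<in> K"
  by (simp add: divide_inverse is_subfield_mult is_subfield_inverse)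

lemma is_subfield_power: "is_subfield K \<Longrightarrow> a \<in> K \<Longrightarrow> a ^ n \<in> K"
  by (induction n) (simp_all add: is_subfield_1 is_subfield_mult)

lemma is_subfield_sum: "is_subfield K \<Longrightarrow> (\<And>i. i \<in> A \<Longrightarrow> f i \<in> K) \<Longrightarrow> sum f A \<in> K"
  by (induction A rule: infinite_finite_induct) (simp_all add: is_subfield_0 is_subfield_add)

lemma is_subfield_prod: "is_subfield K \<Longrightarrow> (\<And>i. i \<in> A \<Longrightarrow> f i \<in> K) \<Longrightarrow> prod f A \<in> K"
  by (induction A rule: infinite_finite_induct) (simp_all add: is_subfield_1 is_subfield_mult)

lemma is_subfield_of_nat: "is_subfield K \<Longrightarrow> of_nat n \<in> K"
  by (induction n) (simp_all add: is_subfield_0 is_subfield_1 is_subfield_add)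

lemmas is_subfield_closed = is_subfield_0 is_subfield_1 is_subfield_add is_subfield_diff
  is_subfield_mult is_subfield_inverse is_subfield_uminus is_subfield_divide is_subfield_power
  is_subfield_sum is_subfield_prod is_subfield_of_nat

lemma is_subfield_poly:
  assumes "is_subfield K" "\<forall>n. Polynomial.coeff P n \<in> K" "a \<in> K"
  shows "poly P a \<in> K"
  unfolding poly_altdef using assms by (auto intro!: is_subfield_closed)

lemma is_subfield_hull: "is_subfield (is_subfield hull S)"
  by (rule hull_in) (auto simp: is_subfield_def)

lemma algebraic_over_mono: "algebraic_over K a \<Longrightarrow> K \<subseteq> L \<Longrightarrow> algebraic_over L a"
  unfolding algebraic_over_def by blast

lemma algebraic_over_self:
  assumes "is_subfield K" "a \<in> K" shows "algebraic_over K a"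
  unfolding algebraic_over_def
proof (intro exI conjI allI)
  show "[:-a, 1:] \<noteq> 0" "poly [:-a, 1:] a = 0" by simp_all
  show "Polynomial.coeff [:-a, 1:] n \<in> K" for n
    using assms by (auto simp: coeff_pCons is_subfield_closed split: nat.split)
qed

text \<open>
  The next two lemmas translate between subsets of a field type and subfields of the
  corresponding record, so that closure of the algebraic elements under the field operations can be
  taken from the theory of finite extensions.
\<close>

lemma subfield_ring_of_type_algebra_iff:
  fixes K :: "'a::field set"
  shows "subfield K ring_of_type_algebra \<longleftrightarrow> is_subfield K"
proof -
  let ?R = "ring_of_type_algebra :: 'a ring"
  interpret R: Ring.field ?R by rule
  have R [simp]: "carrier ?R = UNIV" "monoid.mult ?R = (*)" "monoid.one ?R = 1" "ring.zero ?R = 0" "ring.add ?R = (+)"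
    by (simp_all add: ring_of_type_algebra_def)
  have minus: "a_inv ?R x = - x" for x
    using R.minus_equality[of "- x" x] by simp
  have inv: "m_inv ?R x = inverse x" if "x \<noteq> 0" for x
    using R.comm_inv_char[of x "inverse x"] that by simp
  show ?thesis
  proof
    assume sf: "subfield K ?R"
    then have sr: "subring K ?R" by (simp add: subfieldE(1))
    have m: "a - b \<in> K" if "a \<in> K" "b \<in> K" for a b
      using subringE(5,7)[OF sr] that minus by (metis R(5) diff_conv_add_uminus)
    have i: "inverse a \<in> K" if "a \<in> K" for a
      using R.subfield_m_inv(1)[OF sf, of a] that inv[of a] by (cases "a = 0") auto
    show "is_subfield K"
      unfolding is_subfield_def using subringE(3,6)[OF sr] m i by auto
  next
    assume K: "is_subfield K"
    show "subfield K ?R"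
      by (intro R.subfieldI' R.subringI) (auto simp: minus inv intro!: is_subfield_closed[OF K])
  qed
qed

lemma algebraic_ring_of_type_algebra_iff:
  fixes K :: "'a::field set"
  assumes K: "is_subfield K"
  shows "(ring.algebraic ring_of_type_algebra over K) a \<longleftrightarrow> algebraic_over K a"
proof -
  let ?R = "ring_of_type_algebra :: 'a ring"
  interpret R: Ring.field ?R by rule
  have R [simp]: "carrier ?R = UNIV" "monoid.mult ?R = (*)" "monoid.one ?R = 1" "ring.zero ?R = 0" "ring.add ?R = (+)"
    by (simp_all add: ring_of_type_algebra_def)
  have sr: "subring K ?R"
    using K subfield_ring_of_type_algebra_iff subfieldE(1) by blast
  have pow [simp]: "x [^]\<^bsub>?R\<^esub> (n::nat) = x ^ n" for x n
    by (induction n) (simp_all add: mult.commute)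
  have ev: "R.eval p a = poly (Poly (rev p)) a" for p
    by (induction p) (simp_all add: Poly_append poly_monom algebra_simps)
  show ?thesis
  proof
    assume "(R.algebraic over K) a"
    then obtain p where p: "p \<in> carrier (K[X]\<^bsub>?R\<^esub>)" "p \<noteq> []" "R.eval p a = 0"
      using R.algebraicE[OF sr] by force
    then have *: "set p \<subseteq> K" "hd p \<noteq> 0"
      by (auto simp: univ_poly_def polynomial_def)
    have nz: "Poly (rev p) \<noteq> 0"
    proof
      assume "Poly (rev p) = 0"
      then obtain n where "rev p = replicate n 0" by (auto simp: Poly_eq_0)
      then have "set p \<subseteq> {0}" by (metis set_rev set_replicate_conv_if empty_subsetI subset_refl)
      then show False using * p(2) by (metis hd_in_set singletonD subset_iff)
    qed
    have "Polynomial.coeff (Poly (rev p)) n \<in> K" for n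
      using *(1) is_subfield_0[OF K] nth_mem[of n "rev p"]
      by (auto simp: nth_default_def coeff_Poly_eq simp del: nth_mem)
    with nz p(3) show "algebraic_over K a" unfolding algebraic_over_def ev by blast
  next
    assume "algebraic_over K a"
    then obtain P where P: "P \<noteq> 0" "\<forall>n. Polynomial.coeff P n \<in> K" "poly P a = 0"
      unfolding algebraic_over_def by blast
    have "set (coeffs P) \<subseteq> K" using P(2) by (auto simp: coeffs_def)
    then have "rev (coeffs P) \<in> carrier (K[X]\<^bsub>?R\<^esub>)"
      using P(1) last_coeffs_eq_coeff_degree[OF P(1)] by (auto simp: univ_poly_def polynomial_def hd_rev)
    then show "(R.algebraic over K) a"
      using R.algebraicI[of "rev (coeffs P)" K a] P by (simp add: ev)
  qed
qed

lemma is_subfield_algebraic_over: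
  assumes K: "is_subfield (K :: 'a::field set)"
  shows "is_subfield {a. algebraic_over K a}"
proof -
  interpret R: Ring.field "ring_of_type_algebra :: 'a ring" by rule
  have "subfield K ring_of_type_algebra"
    using K by (simp add: subfield_ring_of_type_algebra_iff)
  from R.subfield_of_algebraics[OF this] show ?thesis
    by (simp add: subfield_ring_of_type_algebra_iff algebraic_ring_of_type_algebra_iff[OF K])
       (simp add: ring_of_type_algebra_def)
qed

text \<open>The equation of $q(a)$, composed with $q$, is an equation of $a$.\<close>

lemma algebraic_over_poly_imp:
  assumes K: "is_subfield K" and q: "\<forall>n. Polynomial.coeff q n \<in> K" "Polynomial.degree q > 0"
    and alg: "algebraic_over K (poly q a)"
  shows "algebraic_over K a"
proof -
  obtain P where P: "P \<noteq> 0" "\<forall>n. Polynomial.coeff P n \<in> K" "poly P (poly q a) = 0"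
    using alg unfolding algebraic_over_def by blast
  have "\<forall>n. Polynomial.coeff (pcompose P q) n \<in> K"
    using P(2)
  proof (induction P)
    case (pCons c P)
    have "\<forall>n. Polynomial.coeff P n \<in> K" and c: "c \<in> K"
      using pCons.prems by (metis coeff_pCons_Suc, metis coeff_pCons_0)
    with pCons.IH have "\<forall>n. Polynomial.coeff (q * pcompose P q) n \<in> K"
      using q(1) by (auto simp: coeff_mult intro!: is_subfield_closed[OF K])
    with c show ?case
      by (auto simp: pcompose_pCons coeff_pCons is_subfield_closed[OF K] split: nat.split)
  qed (simp add: is_subfield_0[OF K])
  moreover have "pcompose P q \<noteq> 0" using P(1) q(2) by (simp add: pcompose_eq_0_iff)
  moreover have "poly (pcompose P q) a = 0" using P(3) by (simp add: poly_pcompose)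
  ultimately show ?thesis unfolding algebraic_over_def by blast
qed

lemma algebraic_over_artin_schreier_root:
  assumes K: "is_subfield K" and "n > 1" and alg: "algebraic_over K (a - a ^ n)"
  shows "algebraic_over K a"
proof (rule algebraic_over_poly_imp[OF K])
  let ?q = "Polynomial.monom 1 1 - Polynomial.monom 1 n :: 'a poly"
  show "\<forall>k. Polynomial.coeff ?q k \<in> K"
    by (auto simp: is_subfield_closed[OF K])
  have "Polynomial.coeff ?q n \<noteq> 0" using assms(2) by simp
  then have "n \<le> Polynomial.degree ?q" by (rule le_degree)
  then show "Polynomial.degree ?q > 0" using assms(2) by simp
  show "algebraic_over K (poly ?q a)" using alg by (simp add: poly_monom)
qed

lemma algebraic_over_image:
  fixes \<phi> :: "'a::field \<Rightarrow> 'b::field"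
  assumes hom: "\<phi> 1 = 1" "\<And>a b. \<phi> (a + b) = \<phi> a + \<phi> b" "\<And>a b. \<phi> (a * b) = \<phi> a * \<phi> b"
    and K: "\<phi> ` K \<subseteq> L" and alg: "algebraic_over K a"
  shows "algebraic_over L (\<phi> a)"
proof -
  have "\<phi> 0 + \<phi> 0 = \<phi> 0 + 0" by (simp flip: hom(2))
  then have 0: "\<phi> 0 = 0" by (simp only: add_left_cancel)
  have inj: "c = 0" if "\<phi> c = 0" for c
  proof (rule ccontr)
    assume "c \<noteq> 0"
    then have "\<phi> c * \<phi> (inverse c) = 1" by (simp add: hom(1) flip: hom(3))
    with that show False by simp
  qed
  obtain P where P: "P \<noteq> 0" "\<forall>n. Polynomial.coeff P n \<in> K" "poly P a = 0"
    using alg unfolding algebraic_over_def by blast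
  have "poly (map_poly \<phi> P) (\<phi> a) = \<phi> (poly P a)"
    by (induction P) (simp_all add: 0 hom map_poly_pCons)
  moreover have "map_poly \<phi> P \<noteq> 0" using P(1) inj by (metis map_poly_eq_0_iff 0)
  ultimately show ?thesis
    unfolding algebraic_over_def using P K
    by (intro exI[of _ "map_poly \<phi> P"]) (auto simp: coeff_map_poly 0)
qed

section \<open>Power series in characteristic p\<close>

lemma char_poly_mapping [simp]:
  "CHAR('a::comm_monoid_add \<Rightarrow>\<^sub>0 'b::comm_ring_1) = CHAR('b)"
proof (rule CHAR_eqI)
  show "of_nat CHAR('b) = (0 :: 'a \<Rightarrow>\<^sub>0 'b)"
    by (metis of_nat_CHAR single_of_nat single_zero)
  show "CHAR('b) dvd n" if "of_nat n = (0 :: 'a \<Rightarrow>\<^sub>0 'b)" for n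
    using arg_cong[OF that, of "\<lambda>f. Poly_Mapping.lookup f 0"]
    by (simp add: lookup_of_nat of_nat_eq_0_iff_char_dvd)
qed

instance poly_mapping :: (comm_monoid_add, comm_ring_prime_char) semiring_prime_char
  by (rule semiring_prime_charI) simp

instance poly_mapping :: (comm_monoid_add, comm_ring_prime_char) comm_ring_prime_char
  by standard

text \<open>
  Only the coefficients up to $n$ matter, and on the truncation the $p$-th power is additive.
\<close>

lemma fps_power_char_nth:
  fixes f :: "'a::comm_ring_prime_char fps"
  shows "fps_nth (f ^ CHAR('a)) n =
    (if CHAR('a) dvd n then fps_nth f (n div CHAR('a)) ^ CHAR('a) else 0)"
proof -
  let ?p = "CHAR('a)"
  have p: "0 < ?p" by simp
  have f: "f = (\<Sum>k\<le>n. fps_const (fps_nth f k) * fps_X ^ k) + fps_X ^ Suc n * fps_shift (Suc n) f"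
    (is "_ = ?g + ?h")
    by (intro fps_ext)
      (auto simp: fps_sum_nth fps_X_power_mult_nth mult_delta_right simp del: power_Suc)
  have "f ^ ?p = (?g + ?h) ^ ?p" by (rule arg_cong[OF f])
  also have "\<dots> = ?g ^ ?p + ?h ^ ?p"
    by (rule freshmans_dream) simp_all
  also have g: "?g ^ ?p = (\<Sum>k\<le>n. fps_const (fps_nth f k ^ ?p) * fps_X ^ (k * ?p))"
    by (subst freshmans_dream_sum) (simp_all add: power_mult_distrib power_mult)
  finally have "fps_nth (f ^ ?p) n =
      (\<Sum>k\<le>n. if n = k * ?p then fps_nth f k ^ ?p else 0) + fps_nth (?h ^ ?p) n"
    by (simp add: fps_sum_nth if_distrib cong: if_cong)
  also have "fps_nth (?h ^ ?p) n = 0"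
  proof -
    have "?h ^ ?p = fps_X ^ (Suc n * ?p) * fps_shift (Suc n) f ^ ?p"
      by (simp only: power_mult_distrib power_mult)
    moreover have "n < Suc n * ?p" using p by (cases ?p) auto
    ultimately show ?thesis by (simp add: fps_X_power_mult_nth)
  qed
  also have "(\<Sum>k\<le>n. if n = k * ?p then fps_nth f k ^ ?p else 0) =
      (if ?p dvd n then fps_nth f (n div ?p) ^ ?p else 0)"
  proof (cases "?p dvd n")
    case True
    then have "n = k * ?p \<longleftrightarrow> k = n div ?p" for k using p by auto
    then show ?thesis using True by (simp add: div_le_dividend)
  next
    case False
    then have "n \<noteq> k * ?p" for k by auto
    with False show ?thesis by simp
  qed
  finally show ?thesis by simp
qed

lemma diff_power_char:
  fixes a b :: "'a::comm_ring_prime_char"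
  assumes "n = CHAR('a)"
  shows "(a - b) ^ n = a ^ n - b ^ n"
proof -
  have "(a - b + b) ^ n = (a - b) ^ n + b ^ n"
    using assms by (intro freshmans_dream) auto
  then show ?thesis unfolding diff_add_cancel by (simp only: eq_diff_eq)
qed

text \<open>
  For $w$ without constant term this is the solution $w + w^p + w^{p^2} + \cdots$ of
  $G - G^p = w$. By the formula for the coefficients of a $p$-th power, the equation determines
  the coefficients recursively.
\<close>

function artin_schreier_coeff :: "'a::comm_ring_prime_char fps \<Rightarrow> nat \<Rightarrow> 'a" where
  "artin_schreier_coeff w n = fps_nth w n +
     (if 0 < n \<and> CHAR('a) dvd n then artin_schreier_coeff w (n div CHAR('a)) ^ CHAR('a) else 0)"
  by auto
termination
proof (relation "measure snd")
  fix w :: "'a fps" and n :: nat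
  have "1 < CHAR('a)" using CHAR_prime[where ?'a = 'a] prime_gt_1_nat by blast
  moreover assume "0 < n \<and> CHAR('a) dvd n"
  ultimately show "((w, n div CHAR('a)), (w, n)) \<in> measure snd" by simp
qed simp

declare artin_schreier_coeff.simps [simp del]

definition artin_schreier :: "'a::comm_ring_prime_char fps \<Rightarrow> 'a fps" where
  "artin_schreier w = Abs_fps (artin_schreier_coeff w)"

lemma artin_schreier_diff_power:
  fixes w :: "'a::comm_ring_prime_char fps"
  assumes "fps_nth w 0 = 0"
  shows "artin_schreier w - artin_schreier w ^ CHAR('a) = w"
proof (rule fps_ext)
  fix n
  show "fps_nth (artin_schreier w - artin_schreier w ^ CHAR('a)) n = fps_nth w n"
    using assms artin_schreier_coeff.simps[of w n]
    by (cases "n = 0") (auto simp: artin_schreier_def fps_power_char_nth power_0_left)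
qed

text \<open>
  Every coefficient of the solution is built from coefficients of \<open>w\<close> by additions and
  $p$-th powers, so it stays in every set that contains those and is closed under these
  operations.
\<close>

lemma artin_schreier_nth_in:
  fixes w :: "'a::comm_ring_prime_char fps"
  assumes "\<And>n. fps_nth w n \<in> S" and "\<And>a b. a \<in> S \<Longrightarrow> b \<in> S \<Longrightarrow> a + b \<in> S"
    and "\<And>a. a \<in> S \<Longrightarrow> a ^ CHAR('a) \<in> S"
  shows "fps_nth (artin_schreier w) n \<in> S"
proof (induction n rule: less_induct)
  case (less n)
  have "1 < CHAR('a)" using CHAR_prime[where ?'a = 'a] prime_gt_1_nat by blast
  then have "n div CHAR('a) < n" if "0 < n" using that by simp
  with less show ?case
    using assms artin_schreier_coeff.simps[of w n] by (auto simp: artin_schreier_def)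
qed

text \<open>
  Only coefficients of \<open>w\<close> up to the same index enter, so the order of vanishing is inherited.
\<close>

lemma artin_schreier_nth_eq_0:
  fixes w :: "'a::comm_ring_prime_char fps"
  assumes "\<And>n. n < N \<Longrightarrow> fps_nth w n = 0" and "n < N"
  shows "fps_nth (artin_schreier w) n = 0"
  using assms(2)
proof (induction n rule: less_induct)
  case (less n)
  have "1 < CHAR('a)" using CHAR_prime[where ?'a = 'a] prime_gt_1_nat by blast
  then have *: "n div CHAR('a) < n" if "0 < n" using that by simp
  have "artin_schreier_coeff w (n div CHAR('a)) = 0" if "0 < n"
    using less.IH[OF *[OF that]] *[OF that] less.prems by (simp add: artin_schreier_def)
  then show ?case
    using assms(1)[OF less.prems] artin_schreier_coeff.simps[of w n]
    by (auto simp: artin_schreier_def power_0_left)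
qed

section \<open>Logarithmic derivatives of power series\<close>

abbreviation theta :: "'a::comm_ring_1 fps \<Rightarrow> 'a fps" where
  "theta f \<equiv> fps_X * fps_deriv f"

lemma theta_nth: "fps_nth (theta f) n = of_nat n * fps_nth f n"
  by (cases n) simp_all

lemma theta_mult: "theta (f * g) = theta f * g + f * theta g"
  by (simp add: algebra_simps)

lemma theta_power: "theta (f ^ n) = of_nat n * f ^ (n - 1) * theta f"
  by (simp add: fps_deriv_power fps_of_nat algebra_simps)

lemma mod_ring_power_card: "(a :: 'p::prime_card mod_ring) ^ CARD('p) = a"
  using finite_field_power_card_eq_same[of a] by simp

text \<open>The projection of $\mathbb{F}_p[[x]]$ onto $\mathbb{F}_p[[x^p]]$, the kernel of $\theta$.\<close>

definition p_section :: "'p::prime_card mod_ring fps \<Rightarrow> 'p mod_ring fps" where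
  "p_section f = Abs_fps (\<lambda>n. if CARD('p) dvd n then fps_nth f n else 0)"

lemma of_nat_mod_ring_eq_0_iff: "of_nat n = (0 :: 'p::prime_card mod_ring) \<longleftrightarrow> CARD('p) dvd n"
  by (simp add: of_nat_eq_0_iff_char_dvd)

text \<open>On $x^n$ the operator $\theta^{p-1}$ is multiplication by $n^{p-1}$, which is $0$ or $1$.\<close>

lemma p_section_eq:
  "p_section f = f - (theta ^^ (CARD('p) - 1)) (f :: 'p::prime_card mod_ring fps)"
proof (rule fps_ext)
  fix n
  have iter: "fps_nth ((theta ^^ k) f) n = of_nat n ^ k * fps_nth f n" for k
    by (induction k) (simp_all add: theta_nth)
  have p: "CARD('p) - 1 > 0" using prime_card[where ?'a = 'p] prime_gt_1_nat by fastforce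
  show "fps_nth (p_section f) n = fps_nth (f - (theta ^^ (CARD('p) - 1)) f) n"
  proof (cases "CARD('p) dvd n")
    case True
    then have "of_nat n = (0 :: 'p mod_ring)" by (simp add: of_nat_mod_ring_eq_0_iff)
    with True p show ?thesis by (simp add: p_section_def iter)
  next
    case False
    then have nz: "of_nat n \<noteq> (0 :: 'p mod_ring)" by (simp add: of_nat_mod_ring_eq_0_iff)
    have "(of_nat n :: 'p mod_ring) * of_nat n ^ (CARD('p) - 1) = of_nat n * 1"
      using mod_ring_power_card[of "of_nat n"] p
      by (metis Suc_diff_1 mult.right_neutral power_Suc zero_less_card_finite)
    then have "(of_nat n :: 'p mod_ring) ^ (CARD('p) - 1) = 1" using nz by (simp only: mult_cancel_left) simp
    with False show ?thesis by (simp add: p_section_def iter)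
  qed
qed

text \<open>
  Over the integers $p\,U^{p-1}\theta U = \theta(U^p)$, and the coefficient of $x^{pn}$
  on the right is $pn$ times that of $U^p$. The integer $p$ has to be cancelled before
  reducing modulo $p$, and this is why $u$ is lifted to integer coefficients.
\<close>

lemma nth_power_times_theta:
  fixes u :: "'p::prime_card mod_ring fps"
  shows "fps_nth (u ^ (CARD('p) - 1) * theta u) (CARD('p) * n) = of_nat n * fps_nth u n"
proof -
  let ?p = "CARD('p)"
  define red :: "int fps \<Rightarrow> 'p mod_ring fps" where "red f = Abs_fps (\<lambda>n. of_int (fps_nth f n))" for f
  have red_mult: "red (f * g) = red f * red g" for f g
    by (intro fps_ext) (simp add: red_def fps_mult_nth)
  have red_1: "red 1 = 1" by (intro fps_ext) (simp add: red_def)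
  have red_power: "red (f ^ k) = red f ^ k" for f k
    by (induction k) (simp_all add: red_mult red_1)
  have red_theta: "red (theta f) = theta (red f)" for f
    by (intro fps_ext) (simp add: red_def theta_nth)
  define U where "U = Abs_fps (\<lambda>n. to_int_mod_ring (fps_nth u n))"
  have U: "red U = u"
    by (intro fps_ext) (simp add: red_def U_def of_int_of_int_mod_ring)
  have "of_nat ?p * (U ^ (?p - 1) * theta U) = theta (U ^ ?p)"
    by (simp add: theta_power mult.assoc)
  then have "int ?p * fps_nth (U ^ (?p - 1) * theta U) (?p * n) =
      int ?p * (int n * fps_nth (U ^ ?p) (?p * n))"
    by (metis (no_types, lifting) fps_mult_left_const_nth fps_of_nat mult.assoc of_nat_mult theta_nth)
  then have "fps_nth (U ^ (?p - 1) * theta U) (?p * n) = int n * fps_nth (U ^ ?p) (?p * n)"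
    by simp
  then have "fps_nth (red (U ^ (?p - 1) * theta U)) (?p * n) = of_nat n * fps_nth (red (U ^ ?p)) (?p * n)"
    by (simp add: red_def)
  then have "fps_nth (u ^ (?p - 1) * theta u) (?p * n) = of_nat n * fps_nth (u ^ ?p) (?p * n)"
    by (subst (asm) red_mult) (simp only: red_power red_theta U)
  also have "fps_nth (u ^ ?p) (?p * n) = fps_nth u n"
    using fps_power_char_nth[of u "?p * n"] by (simp add: mod_ring_power_card)
  finally show ?thesis .
qed

text \<open>
  Jacobson's formula: a logarithmic derivative $\beta$ satisfies
  $\theta^{p-1}\beta + \beta^p = \beta$. As $u^p$ is a $\theta$-constant, it can be moved in and
  out of the $p$-section, and $u^p\beta = u^{p-1}\theta u$ is covered by the preceding lemma.
\<close>

lemma p_section_log_derivative: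
  fixes u \<beta> :: "'p::prime_card mod_ring fps"
  assumes u: "fps_nth u 0 \<noteq> 0" and eq: "theta u = \<beta> * u"
  shows "p_section \<beta> = \<beta> ^ CARD('p)"
proof -
  let ?p = "CARD('p)"
  have p: "?p > 0" by simp
  have th0: "theta (u ^ ?p) = 0"
    using theta_power[of u ?p] by (simp flip: fps_of_nat add: of_nat_mod_ring_eq_0_iff)
  have "(theta ^^ k) (u ^ ?p * \<beta>) = u ^ ?p * (theta ^^ k) \<beta>" for k
    by (induction k) (use th0 in \<open>simp_all add: theta_mult\<close>)
  then have "u ^ ?p * p_section \<beta> = p_section (u ^ ?p * \<beta>)"
    by (simp add: p_section_eq algebra_simps)
  also have "u ^ ?p * \<beta> = u ^ (?p - 1) * theta u"
    unfolding eq using power_Suc2[of u "?p - 1"] p by (simp add: algebra_simps)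
  also have "p_section (u ^ (?p - 1) * theta u) = theta u ^ ?p"
  proof (rule fps_ext)
    fix n
    show "fps_nth (p_section (u ^ (?p - 1) * theta u)) n = fps_nth (theta u ^ ?p) n"
      using fps_power_char_nth[of "theta u" n] nth_power_times_theta[of u "n div ?p"]
      by (auto simp: p_section_def mod_ring_power_card theta_nth)
  qed
  also have "\<dots> = u ^ ?p * \<beta> ^ ?p" by (simp add: eq power_mult_distrib mult.commute)
  finally show ?thesis using u by (metis fps_zero_nth mult_left_cancel power_not_zero)
qed

section \<open>Derivatives of algebraic series are algebraic\<close>

lemma is_subfield_rat_funs: "is_subfield rat_funs"
  unfolding rat_funs_def by (rule is_subfield_hull)

lemma fls_const_in_rat_funs: "fls_const c \<in> rat_funs"
  and fls_X_in_rat_funs: "fls_X \<in> rat_funs"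
  unfolding rat_funs_def by (auto intro: hull_inc)

lemma rat_funs_induct:
  assumes "q \<in> rat_funs" and "is_subfield S" and "\<And>c. fls_const c \<in> S" and "fls_X \<in> S"
  shows "q \<in> S"
  using hull_minimal[of "range fls_const \<union> {fls_X}" S is_subfield] assms
  unfolding rat_funs_def by blast

lemma fls_deriv_in_rat_funs:
  fixes q :: "'p::prime_card mod_ring fls"
  assumes "q \<in> rat_funs" shows "fls_deriv q \<in> rat_funs"
proof -
  let ?S = "{q \<in> rat_funs. fls_deriv q \<in> rat_funs}"
  have "q \<in> ?S"
  proof (rule rat_funs_induct[OF assms])
    show "is_subfield ?S"
      unfolding is_subfield_def
      by (auto simp: fls_inverse_deriv' is_subfield_rat_funs intro!: is_subfield_closed)
  qed (auto simp: fls_const_in_rat_funs fls_X_in_rat_funs is_subfield_closed is_subfield_rat_funs)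
  then show ?thesis by blast
qed

text \<open>
  The powers $1, x, \ldots, x^{p-1}$ span $\mathbb{F}_p(x)$ over its subfield of $p$-th powers:
  the span contains the generators and is closed under subtraction and multiplication, hence also
  under inverses, since $q^{-1} = q^{p-1} (q^{-1})^p$.
\<close>

lemma rat_funs_p_basis:
  fixes q :: "'p::prime_card mod_ring fls"
  assumes "q \<in> rat_funs"
  shows "\<exists>r. (\<forall>i. r i \<in> rat_funs) \<and> q = (\<Sum>i<CARD('p). fls_X ^ i * r i ^ CARD('p))"
proof -
  let ?p = "CARD('p)"
  let ?K = "rat_funs :: 'p mod_ring fls set"
  let ?S = "{q. \<exists>r. (\<forall>i. r i \<in> ?K) \<and> q = (\<Sum>i<?p. fls_X ^ i * r i ^ ?p)}"
  have K: "is_subfield ?K" by (rule is_subfield_rat_funs)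
  have p1: "1 < ?p" using prime_card[where ?'a = 'p] prime_gt_1_nat by blast
  have diff_power: "(a - b) ^ ?p = a ^ ?p - b ^ ?p" for a b :: "'p mod_ring fls"
    by (rule diff_power_char) simp
  have diff: "a - b \<in> ?S" if ab: "a \<in> ?S" "b \<in> ?S" for a b
  proof -
    from ab obtain r s where "\<forall>i. r i \<in> ?K" "\<forall>i. s i \<in> ?K"
      "a = (\<Sum>i<?p. fls_X ^ i * r i ^ ?p)" "b = (\<Sum>i<?p. fls_X ^ i * s i ^ ?p)" by blast
    then show ?thesis
      by (intro CollectI exI[of _ "\<lambda>i. r i - s i"])
         (auto simp: diff_power right_diff_distrib sum_subtractf is_subfield_closed[OF K])
  qed
  have zero: "0 \<in> ?S"
    by (intro CollectI exI[of _ "\<lambda>_. 0"]) (use p1 in \<open>auto simp: is_subfield_closed[OF K] power_0_left\<close>)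
  have plus: "a + b \<in> ?S" if ab: "a \<in> ?S" "b \<in> ?S" for a b
    using diff[OF ab(1) diff[OF zero ab(2)]] by simp
  have sum: "sum f A \<in> ?S" if "\<And>i. i \<in> A \<Longrightarrow> f i \<in> ?S" for f :: "nat \<Rightarrow> _" and A
    using that by (induction A rule: infinite_finite_induct) (use zero plus in auto)
  have monom: "fls_X ^ i * c ^ ?p \<in> ?S" if "c \<in> ?K" for i c
  proof (intro CollectI exI conjI allI)
    let ?r = "\<lambda>j. if j = i mod ?p then fls_X ^ (i div ?p) * c else 0"
    show "?r j \<in> ?K" for j
      using that by (auto simp: fls_X_in_rat_funs is_subfield_closed[OF K])
    have "(\<Sum>j<?p. fls_X ^ j * ?r j ^ ?p) = fls_X ^ (i mod ?p) * (fls_X ^ (i div ?p) * c) ^ ?p"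
      by (subst sum.remove[of _ "i mod ?p"]) (auto simp: power_0_left)
    also have "\<dots> = fls_X ^ (i mod ?p + i div ?p * ?p) * c ^ ?p"
      by (simp only: power_mult_distrib power_add power_mult mult.assoc)
    finally show "fls_X ^ i * c ^ ?p = (\<Sum>j<?p. fls_X ^ j * ?r j ^ ?p)" by simp
  qed
  \<comment> \<open>Products of basis elements leave the range of exponents; \<open>monom\<close> reduces them again.\<close>
  have mult: "a * b \<in> ?S" if ab: "a \<in> ?S" "b \<in> ?S" for a b
  proof -
    from ab obtain r s where rs: "\<forall>i. r i \<in> ?K" "\<forall>i. s i \<in> ?K" and
      eq: "a = (\<Sum>i<?p. fls_X ^ i * r i ^ ?p)" "b = (\<Sum>i<?p. fls_X ^ i * s i ^ ?p)" by blast
    have "a * b = (\<Sum>i<?p. \<Sum>j<?p. fls_X ^ (i + j) * (r i * s j) ^ ?p)"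
      by (simp add: eq sum_product power_add power_mult_distrib mult_ac)
    also have "\<dots> \<in> ?S" using rs by (intro sum monom is_subfield_mult[OF K]) auto
    finally show ?thesis .
  qed
  have const: "fls_const c \<in> ?S" for c
  proof -
    have "fls_const c ^ ?p = fls_const (c ^ ?p)" by (simp add: fls_const_power)
    then show ?thesis
      using monom[OF fls_const_in_rat_funs, of 0 c] by (simp add: mod_ring_power_card)
  qed
  have power: "a ^ k \<in> ?S" if "a \<in> ?S" for a k
    using that const[of 1] mult by (induction k) auto
  have inv: "inverse a \<in> ?S" if "a \<in> ?S" for a
  proof (cases "a = 0")
    case False
    have "a \<in> ?K" using that by (auto intro!: is_subfield_closed[OF K] fls_X_in_rat_funs)
    then have "fls_X ^ 0 * inverse a ^ ?p \<in> ?S" by (intro monom is_subfield_inverse[OF K])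
    then have "a ^ (?p - 1) * inverse a ^ ?p \<in> ?S" using mult power that by simp
    moreover have "a ^ (?p - 1) * inverse a ^ ?p = inverse a"
      using p1 power_Suc[of "inverse a" "?p - 1"] False by (simp add: power_inverse)
    ultimately show ?thesis by simp
  qed (use zero in simp)
  have "is_subfield ?S"
    unfolding is_subfield_def using const[of 1] diff mult inv by simp
  moreover have "fls_X \<in> ?S" using monom[of 1 1] is_subfield_1[OF K] by simp
  ultimately have "q \<in> ?S" using assms const by (intro rat_funs_induct[of q ?S])
  then show ?thesis by blast
qed

text \<open>
  The orders of vanishing of the summands are distinct modulo $p$, so a summand of smallest
  order cannot be cancelled.
\<close>

lemma p_basis_independent:
  fixes r :: "nat \<Rightarrow> 'p::prime_card mod_ring fls"
  assumes sum: "(\<Sum>i<CARD('p). fls_X ^ i * r i ^ CARD('p)) = 0" and "i < CARD('p)"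
  shows "r i = 0"
proof (rule ccontr)
  let ?p = "CARD('p)"
  let ?t = "\<lambda>i. fls_X ^ i * r i ^ ?p"
  let ?I = "{i. i < ?p \<and> r i \<noteq> 0}"
  assume "r i \<noteq> 0"
  with assms(2) have "finite ?I" "?I \<noteq> {}" by auto
  then obtain j where j: "j \<in> ?I" and min: "\<And>k. k \<in> ?I \<Longrightarrow> fls_subdegree (?t j) \<le> fls_subdegree (?t k)"
    using arg_min_if_finite[of ?I "\<lambda>i. fls_subdegree (?t i)"] by (metis (no_types, lifting) not_less)
  have sd: "fls_subdegree (?t k) = int k + int ?p * fls_subdegree (r k)" if "k \<in> ?I" for k
    using that by (subst fls_subdegree_mult) (auto simp: fls_subdegree_pow)
  have neq: "fls_subdegree (?t k) \<noteq> fls_subdegree (?t j)" if "k \<in> ?I" "k \<noteq> j" for k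
  proof
    assume "fls_subdegree (?t k) = fls_subdegree (?t j)"
    then have "int k + int ?p * fls_subdegree (r k) = int j + int ?p * fls_subdegree (r j)"
      unfolding sd[OF that(1)] sd[OF j] .
    then have "(int k + int ?p * fls_subdegree (r k)) mod int ?p =
        (int j + int ?p * fls_subdegree (r j)) mod int ?p"
      by (rule arg_cong)
    then have "int k mod int ?p = int j mod int ?p" by (simp only: mod_mult_self2)
    with that j show False by simp
  qed
  have "fls_nth (\<Sum>k<?p. ?t k) (fls_subdegree (?t j)) =
      (\<Sum>k<?p. fls_nth (?t k) (fls_subdegree (?t j)))"
    by (simp add: fls_nth_sum)
  also have "\<dots> = (\<Sum>k\<in>{j}. fls_nth (?t k) (fls_subdegree (?t j)))"
  proof (rule sum.mono_neutral_right)
    show "\<forall>k\<in>{..<?p} - {j}. fls_nth (?t k) (fls_subdegree (?t j)) = 0"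
    proof
      fix k assume k: "k \<in> {..<?p} - {j}"
      show "fls_nth (?t k) (fls_subdegree (?t j)) = 0"
      proof (cases "r k = 0")
        case False
        with k have "fls_subdegree (?t j) < fls_subdegree (?t k)"
          using min[of k] neq[of k] by fastforce
        then show ?thesis by (rule fls_eq0_below_subdegree)
      qed (simp add: power_0_left)
    qed
  qed (use j in auto)
  finally have "fls_nth (?t j) (fls_subdegree (?t j)) = 0" unfolding sum by simp
  moreover have "?t j \<noteq> 0" using j by simp
  ultimately show False using nth_fls_subdegree_nonzero by blast
qed

lemma fls_deriv_poly:
  fixes P :: "'a::field fls poly"
  shows "fls_deriv (poly P a) = poly (map_poly fls_deriv P) a + poly (pderiv P) a * fls_deriv a"
proof (induction P)
  case (pCons c P)
  then show ?case by (simp add: map_poly_pCons pderiv_pCons algebra_simps)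
qed simp

text \<open>
  Differentiating the minimal equation $P(a) = 0$ gives $P^\partial(a) + P'(a)\,a' = 0$, which
  can be solved for $a'$ as soon as $P'(a) \ne 0$. Otherwise $P' = 0$ by minimality, so $P$ is a
  polynomial in the $p$-th power of the unknown. Expanding its coefficients in the basis
  $1, x, \ldots, x^{p-1}$ over the $p$-th powers writes $P(a)$ as $\sum_i x^i R_i(a)^p$. By
  independence every $R_i(a)$ vanishes, and the $R_i$ have smaller degree than $P$, a
  contradiction.
\<close>

lemma algebraic_over_fls_deriv:
  fixes a :: "'p::prime_card mod_ring fls"
  assumes alg: "algebraic_over rat_funs a"
  shows "algebraic_over rat_funs (fls_deriv a)"
proof -
  let ?p = "CARD('p)"
  let ?K = "rat_funs :: 'p mod_ring fls set"
  let ?ann = "\<lambda>P. P \<noteq> 0 \<and> (\<forall>n. Polynomial.coeff P n \<in> ?K) \<and> poly P a = 0"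
  have K: "is_subfield ?K" by (rule is_subfield_rat_funs)
  have p1: "1 < ?p" using prime_card[where ?'a = 'p] prime_gt_1_nat by blast
  from alg obtain P where P: "?ann P" and min: "\<And>Q. ?ann Q \<Longrightarrow> Polynomial.degree P \<le> Polynomial.degree Q"
    unfolding algebraic_over_def
    using ex_has_least_nat[of ?ann _ Polynomial.degree] by metis
  have degP: "Polynomial.degree P > 0"
  proof (rule ccontr)
    assume "\<not> ?thesis"
    then obtain c where "P = [:c:]" by (metis degree_eq_zeroE gr0I)
    with P show False by auto
  qed
  have no_smaller: "Q = 0" if "\<forall>n. Polynomial.coeff Q n \<in> ?K" "poly Q a = 0"
      "Polynomial.degree Q < Polynomial.degree P" for Q
    using min[of Q] that by (auto simp flip: not_le)
  have "poly (pderiv P) a \<noteq> 0"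
  proof
    assume root: "poly (pderiv P) a = 0"
    have "pderiv P = 0"
    proof (rule no_smaller[OF _ root])
      show "\<forall>n. Polynomial.coeff (pderiv P) n \<in> ?K"
        using P by (auto simp: coeff_pderiv intro!: is_subfield_closed[OF K])
      show "Polynomial.degree (pderiv P) < Polynomial.degree P"
        using degree_pderiv_le[of P] degP by linarith
    qed
    then have P0: "Polynomial.coeff P n = 0" if n: "\<not> ?p dvd n" for n
    proof -
      obtain m where m: "n = Suc m" using n by (cases n) auto
      have "of_nat n * Polynomial.coeff P n = 0"
        using coeff_pderiv[of P m] \<open>pderiv P = 0\<close> by (simp add: m)
      moreover have "of_nat n \<noteq> (0 :: 'p mod_ring fls)"
        using n by (simp add: of_nat_eq_0_iff_char_dvd)
      ultimately show ?thesis by simp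
    qed
    have "\<forall>m. \<exists>r. (\<forall>i. r i \<in> ?K) \<and>
        Polynomial.coeff P (m * ?p) = (\<Sum>i<?p. fls_X ^ i * r i ^ ?p)"
      using P rat_funs_p_basis by blast
    then obtain r where r: "\<And>m i. r m i \<in> ?K"
      and Pr: "\<And>m. Polynomial.coeff P (m * ?p) = (\<Sum>i<?p. fls_X ^ i * r m i ^ ?p)"
      by metis
    define d where "d = Polynomial.degree P div ?p"
    have d: "d < Polynomial.degree P" using p1 degP by (simp add: d_def)
    define R where "R i = (\<Sum>m\<le>d. Polynomial.monom (r m i) m)" for i
    have coeffR: "Polynomial.coeff (R i) m = (if m \<le> d then r m i else 0)" for i m
      by (simp add: R_def Polynomial.coeff_sum)
    have "0 = poly P a" using P by simp
    also have "\<dots> = (\<Sum>n\<le>Polynomial.degree P. Polynomial.coeff P n * a ^ n)"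
      by (rule poly_altdef)
    also have "\<dots> = (\<Sum>n\<in>(\<lambda>m. m * ?p) ` {..d}. Polynomial.coeff P n * a ^ n)"
    proof (rule sum.mono_neutral_right)
      show "(\<lambda>m. m * ?p) ` {..d} \<subseteq> {..Polynomial.degree P}"
        using p1 by (auto simp: d_def less_eq_div_iff_mult_less_eq)
      show "\<forall>n\<in>{..Polynomial.degree P} - (\<lambda>m. m * ?p) ` {..d}. Polynomial.coeff P n * a ^ n = 0"
      proof
        fix n assume n: "n \<in> {..Polynomial.degree P} - (\<lambda>m. m * ?p) ` {..d}"
        have "\<not> ?p dvd n"
        proof
          assume "?p dvd n"
          then have "n = (n div ?p) * ?p" "n div ?p \<in> {..d}"
            using n by (auto simp: d_def div_le_mono)
          with n show False by blast
        qed
        then show "Polynomial.coeff P n * a ^ n = 0" by (simp add: P0)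
      qed
    qed simp
    also have "\<dots> = (\<Sum>m\<le>d. (\<Sum>i<?p. fls_X ^ i * r m i ^ ?p) * a ^ (m * ?p))"
      using p1 by (subst sum.reindex) (auto simp: inj_on_def Pr)
    also have "\<dots> = (\<Sum>m\<le>d. \<Sum>i<?p. fls_X ^ i * (r m i * a ^ m) ^ ?p)"
      by (simp add: sum_distrib_right power_mult_distrib power_mult mult.assoc)
    also have "\<dots> = (\<Sum>i<?p. fls_X ^ i * (\<Sum>m\<le>d. (r m i * a ^ m) ^ ?p))"
      by (subst sum.swap) (simp add: sum_distrib_left)
    also have "\<dots> = (\<Sum>i<?p. fls_X ^ i * poly (R i) a ^ ?p)"
    proof -
      have "(\<Sum>m\<le>d. (r m i * a ^ m) ^ ?p) = poly (R i) a ^ ?p" for i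
        unfolding R_def poly_sum poly_monom
        by (rule freshmans_dream_sum[symmetric]) (simp_all add: prime_card)
      then show ?thesis by simp
    qed
    finally have "(\<Sum>i<?p. fls_X ^ i * poly (R i) a ^ ?p) = 0" by simp
    then have root: "poly (R i) a = 0" if "i < ?p" for i
      using p_basis_independent[of "\<lambda>i. poly (R i) a"] that by blast
    have "R i = 0" if "i < ?p" for i
    proof (rule no_smaller[OF _ root[OF that]])
      show "\<forall>n. Polynomial.coeff (R i) n \<in> ?K" using r is_subfield_0[OF K] by (simp add: coeffR)
      have "Polynomial.degree (R i) \<le> d" by (rule degree_le) (simp add: coeffR)
      with d show "Polynomial.degree (R i) < Polynomial.degree P" by simp
    qed
    then have "r m i = 0" if "m \<le> d" "i < ?p" for m i
      using coeffR[of i m] that by simp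
    then have "Polynomial.coeff P (m * ?p) = 0" if "m \<le> d" for m
      using that p1 by (simp add: Pr power_0_left)
    moreover have "Polynomial.degree P = d * ?p"
    proof -
      have "?p dvd Polynomial.degree P" using P0 P by (metis leading_coeff_0_iff)
      then show ?thesis by (simp add: d_def)
    qed
    ultimately show False using P by (metis leading_coeff_0_iff order_refl)
  qed
  moreover have "fls_deriv (poly P a) = 0" using P by simp
  ultimately have eq: "fls_deriv a = - poly (map_poly fls_deriv P) a / poly (pderiv P) a"
    by (simp add: fls_deriv_poly field_simps eq_neg_iff_add_eq_0)
  let ?L = "{a. algebraic_over ?K a}"
  have L: "is_subfield ?L" by (rule is_subfield_algebraic_over[OF K])
  have KL: "c \<in> ?L" if "c \<in> ?K" for c using that K by (simp add: algebraic_over_self)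
  have "fls_deriv a \<in> ?L"
    unfolding eq
  proof (intro is_subfield_divide[OF L] is_subfield_uminus[OF L] is_subfield_poly[OF L] allI)
    show "a \<in> ?L" using alg by simp
    then show "a \<in> ?L" .
    show "Polynomial.coeff (map_poly fls_deriv P) n \<in> ?L" for n
      using P by (intro KL) (simp add: coeff_map_poly fls_deriv_in_rat_funs)
    show "Polynomial.coeff (pderiv P) n \<in> ?L" for n
      using P by (intro KL) (auto simp: coeff_pderiv intro!: is_subfield_closed[OF K])
  qed
  then show ?thesis by simp
qed

section \<open>The factor free of the variables z\<close>

text \<open>
  The coefficients $(\beta_n, u_n)$ of a series $\beta$ that agrees with $\alpha$ away from the
  multiples of $p$ and of a solution $u$ of $\theta u = \beta u$. Comparing coefficients of $x^n$,
  the equation reads $n u_n = \beta_n + s_n$, where $s_n$ collects the products of earlier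
  coefficients. If $p \nmid n$ it is solved for $u_n$;
  if $p \mid n$ the left-hand side vanishes, and $\beta_n$ is chosen to be $-s_n$.
\<close>

function log_deriv_pair :: "'p::prime_card mod_ring fps \<Rightarrow> nat \<Rightarrow> 'p mod_ring \<times> 'p mod_ring" where
  "log_deriv_pair \<alpha> n =
     (let s = (\<Sum>k\<in>{1..<n}. fst (log_deriv_pair \<alpha> k) * snd (log_deriv_pair \<alpha> (n - k)))
      in if n = 0 then (0, 1) else if CARD('p) dvd n then (- s, 0)
         else (fps_nth \<alpha> n, (fps_nth \<alpha> n + s) / of_nat n))"
  by pat_completeness simp
termination by (relation "measure snd") simp_all

declare log_deriv_pair.simps [simp del]

lemma exists_formal_solution:
  fixes \<alpha> :: "'p::prime_card mod_ring fps"
  assumes "fps_nth \<alpha> 0 = 0"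
  shows "\<exists>\<beta> u. fps_nth u 0 = 1 \<and> fps_nth \<beta> 0 = 0 \<and> theta u = \<beta> * u \<and>
    (\<forall>n. \<not> CARD('p) dvd n \<longrightarrow> fps_nth \<beta> n = fps_nth \<alpha> n)"
proof -
  define b where "b n = fst (log_deriv_pair \<alpha> n)" for n
  define v where "v n = snd (log_deriv_pair \<alpha> n)" for n
  have b0: "b 0 = 0" and v0: "v 0 = 1"
    unfolding b_def v_def by (subst log_deriv_pair.simps; simp)+
  define s where "s n = (\<Sum>k\<in>{1..<n}. b k * v (n - k))" for n
  have pair: "log_deriv_pair \<alpha> n = (if CARD('p) dvd n then (- s n, 0)
      else (fps_nth \<alpha> n, (fps_nth \<alpha> n + s n) / of_nat n))" if "n > 0" for n
    using that unfolding s_def b_def v_def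
    by (subst log_deriv_pair.simps) (simp add: Let_def)
  have b: "b n = (if CARD('p) dvd n then - s n else fps_nth \<alpha> n)" if "n > 0" for n
    unfolding b_def pair[OF that] by simp
  have bv: "of_nat n * v n = b n + s n" if "n > 0" for n
    using of_nat_mod_ring_eq_0_iff[of n, where ?'p = 'p]
    unfolding b[OF that] unfolding v_def pair[OF that] by simp
  have "theta (Abs_fps v) = Abs_fps b * Abs_fps v"
  proof (rule fps_ext)
    fix n
    show "fps_nth (theta (Abs_fps v)) n = fps_nth (Abs_fps b * Abs_fps v) n"
    proof (cases "n = 0")
      case False
      have "{0..n} = insert 0 (insert n {1..<n})" using False by auto
      then have "fps_nth (Abs_fps b * Abs_fps v) n = b n + s n"
        using False unfolding fps_mult_nth by (simp add: b0 v0 s_def)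
      also have "\<dots> = fps_nth (theta (Abs_fps v)) n"
        using False by (simp only: theta_nth fps_nth_Abs_fps bv)
      finally show ?thesis by (rule sym)
    qed (simp add: b0)
  qed
  moreover have "b n = fps_nth \<alpha> n" if "\<not> CARD('p) dvd n" for n
    using that b[of n] by (cases "n = 0") auto
  ultimately show ?thesis
    using b0 v0 by (intro exI[of _ "Abs_fps b"] exI[of _ "Abs_fps v"]) auto
qed

lemma algebraic_over_theta:
  fixes f :: "'p::prime_card mod_ring fps"
  assumes "algebraic_over rat_funs (fps_to_fls f)"
  shows "algebraic_over rat_funs (fps_to_fls (theta f))"
proof -
  have L: "is_subfield {a :: 'p mod_ring fls. algebraic_over rat_funs a}"
    by (rule is_subfield_algebraic_over[OF is_subfield_rat_funs])
  have "algebraic_over rat_funs (fls_deriv (fps_to_fls f))"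
    by (rule algebraic_over_fls_deriv[OF assms])
  moreover have "algebraic_over rat_funs (fls_X :: 'p mod_ring fls)"
    by (rule algebraic_over_self[OF is_subfield_rat_funs fls_X_in_rat_funs])
  ultimately have "algebraic_over rat_funs (fls_X * fls_deriv (fps_to_fls f))"
    using is_subfield_mult[OF L] by simp
  then show ?thesis by (simp add: fls_times_fps_to_fls fls_deriv_fps_to_fls)
qed

text \<open>
  Start from the formal pair $(\beta, u)$ and put $c = \alpha - \beta$, a $\theta$-constant.
  By Jacobson's formula $\beta - \beta^p = \theta^{p-1}\beta = \theta^{p-1}\alpha$, so $\beta$ is
  algebraic. The series $u$ need not be algebraic, but any multiple of it by a $\theta$-constant solves
  the same equation. With $v = 1/u$ the multiple $h = u\,s$, where $s$ is the $p$-section of $v$, works: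
  $s = v - \theta^{p-1}v$, and $\theta v = -\beta v$ gives $\theta^k v = B_k v$ with $B_k$ a
  polynomial in the derivatives of $\beta$. Hence $h = 1 - B_{p-1}$ is algebraic.
\<close>

lemma exists_algebraic_solution_up_to_p_powers:
  fixes \<alpha> :: "'p::prime_card mod_ring fps"
  assumes \<alpha>0: "fps_nth \<alpha> 0 = 0" and alg: "algebraic_over rat_funs (fps_to_fls \<alpha>)"
  obtains h c where "fps_nth h 0 = 1" "theta h = (\<alpha> - c) * h" "theta c = 0" "fps_nth c 0 = 0"
    "algebraic_over rat_funs (fps_to_fls h)" "algebraic_over rat_funs (fps_to_fls c)"
proof -
  let ?p = "CARD('p)"
  let ?alg = "\<lambda>f :: 'p mod_ring fps. algebraic_over rat_funs (fps_to_fls f)"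
  have L: "is_subfield {a :: 'p mod_ring fls. algebraic_over rat_funs a}"
    by (rule is_subfield_algebraic_over[OF is_subfield_rat_funs])
  have p1: "1 < ?p" using prime_card[where ?'a = 'p] prime_gt_1_nat by blast
  have alg_1: "?alg 1" using is_subfield_1[OF L] by simp
  have alg_diff: "?alg (f - g)" if "?alg f" "?alg g" for f g
    using is_subfield_diff[OF L] that by simp
  have alg_mult: "?alg (f * g)" if "?alg f" "?alg g" for f g
    using is_subfield_mult[OF L] that by (simp add: fls_times_fps_to_fls)
  have alg_iter: "?alg ((theta ^^ k) f)" if "?alg f" for f k
    by (induction k) (use that algebraic_over_theta in auto)
  obtain \<beta> u where u0: "fps_nth u 0 = 1" and \<beta>0: "fps_nth \<beta> 0 = 0" and u: "theta u = \<beta> * u"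
    and \<beta>: "\<And>n. \<not> ?p dvd n \<Longrightarrow> fps_nth \<beta> n = fps_nth \<alpha> n"
    using exists_formal_solution[OF \<alpha>0] by blast
  define c where "c = \<alpha> - \<beta>"
  have c: "fps_nth c n = 0" if "\<not> ?p dvd n" for n using \<beta>[OF that] by (simp add: c_def)
  have theta_section: "theta f = 0" if "\<And>n. \<not> ?p dvd n \<Longrightarrow> fps_nth f n = 0" for f :: "'p mod_ring fps"
  proof (rule fps_ext)
    show "fps_nth (theta f) n = fps_nth 0 n" for n
      using that[of n] of_nat_mod_ring_eq_0_iff[of n, where ?'p = 'p]
      by (simp only: theta_nth) auto
  qed
  have theta_c: "theta c = 0" by (rule theta_section[OF c])
  have alg_\<beta>: "?alg \<beta>"
  proof -
    have "\<beta> ^ ?p = p_section \<beta>"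
      using p_section_log_derivative[OF _ u] u0 by simp
    also have "\<dots> = \<beta> - (theta ^^ (?p - 1)) \<beta>" by (rule p_section_eq)
    also have "(theta ^^ (?p - 1)) \<beta> = (theta ^^ (?p - 1)) \<alpha>"
    proof -
      have "(theta ^^ Suc k) \<beta> = (theta ^^ Suc k) \<alpha>" for k
        by (induction k) (use theta_c in \<open>simp_all add: c_def algebra_simps\<close>)
      from this[of "?p - 2"] show ?thesis using p1 by (simp add: Suc_diff_Suc numeral_2_eq_2)
    qed
    finally have "fps_to_fls \<beta> - fps_to_fls \<beta> ^ ?p = fps_to_fls ((theta ^^ (?p - 1)) \<alpha>)"
      by (simp flip: fps_to_fls_power)
    then have "algebraic_over rat_funs (fps_to_fls \<beta> - fps_to_fls \<beta> ^ ?p)"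
      using alg_iter[OF alg] by simp
    then show ?thesis by (rule algebraic_over_artin_schreier_root[OF is_subfield_rat_funs p1])
  qed
  define v where "v = inverse u"
  have uv: "u * v = 1" using u0 by (simp add: v_def inverse_mult_eq_1')
  have theta_v: "theta v = - \<beta> * v"
  proof -
    have "0 = theta (u * v)" by (simp add: uv)
    also have "\<dots> = u * (\<beta> * v + theta v)" by (simp only: theta_mult u) (simp add: algebra_simps)
    finally show ?thesis using u0 by (auto simp: eq_neg_iff_add_eq_0 add.commute)
  qed
  have "\<exists>B. ?alg B \<and> (theta ^^ k) v = B * v" for k
  proof (induction k)
    case 0
    show ?case using alg_1 by (intro exI[of _ 1]) simp
  next
    case (Suc k)
    then obtain B where B: "?alg B" "(theta ^^ k) v = B * v" by blast
    have "(theta ^^ Suc k) v = theta (B * v)" using B(2) by simp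
    also have "\<dots> = (theta B - B * \<beta>) * v"
      by (simp only: theta_mult theta_v) (simp add: algebra_simps)
    finally show ?case
      using alg_diff[OF algebraic_over_theta[OF B(1)] alg_mult[OF B(1) alg_\<beta>]] by blast
  qed
  then obtain B where B: "?alg B" "(theta ^^ (?p - 1)) v = B * v" by blast
  define h where "h = u * p_section v"
  show ?thesis
  proof
    have "h = u * (v - B * v)" unfolding h_def p_section_eq B(2) ..
    also have "\<dots> = u * v - B * (u * v)" by (simp add: algebra_simps)
    finally have "h = u * v - B * (u * v)" .
    then show "?alg h" using alg_diff[OF alg_1 B(1)] by (simp add: uv)
    have "fps_nth v 0 = 1" using u0 by (simp add: v_def)
    then show "fps_nth h 0 = 1" using u0 by (simp add: h_def p_section_def)
    have "theta (p_section v) = 0" by (rule theta_section) (simp add: p_section_def)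
    then have "theta h = \<beta> * h"
      unfolding h_def by (simp only: theta_mult u) (simp add: mult.assoc)
    then show "theta h = (\<alpha> - c) * h" by (simp add: c_def)
    show "theta c = 0" by (rule theta_c)
    show "fps_nth c 0 = 0" by (simp add: c_def \<alpha>0 \<beta>0)
    show "?alg c" unfolding c_def by (rule alg_diff[OF alg alg_\<beta>])
  qed
qed

section \<open>A substitute for the exponential function\<close>

text \<open>
  Telescoping $\sum_{j<p} ((j+1)^{k+1} - j^{k+1}) = p^{k+1}$ expresses $k+1$ times the sum by
  sums with smaller exponent, and $k + 1 < p$ is invertible modulo $p$.
\<close>

lemma prime_dvd_power_sum:
  assumes p: "normalization_semidom_class.prime (p::nat)" and "k < p - 1"
  shows "int p dvd (\<Sum>j<p. int j ^ k)"
  using assms(2)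
proof (induction k rule: less_induct)
  case (less k)
  let ?S = "\<lambda>i. \<Sum>j<p. int j ^ i"
  have "int p ^ Suc k = (\<Sum>j<p. int (Suc j) ^ Suc k - int j ^ Suc k)"
    by (subst sum_lessThan_telescope) simp
  also have "\<dots> = (\<Sum>j<p. \<Sum>i\<le>k. int (Suc k choose i) * int j ^ i)"
  proof (rule sum.cong[OF refl])
    fix j
    have "int (Suc j) ^ Suc k = (int j + 1) ^ Suc k" by (simp only: of_nat_Suc add.commute)
    also have "\<dots> = (\<Sum>i\<le>Suc k. int (Suc k choose i) * int j ^ i)"
      by (subst binomial_ring) simp
    also have "\<dots> = (\<Sum>i\<le>k. int (Suc k choose i) * int j ^ i) + int j ^ Suc k" by simp
    finally show "int (Suc j) ^ Suc k - int j ^ Suc k = (\<Sum>i\<le>k. int (Suc k choose i) * int j ^ i)"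
      by (simp only: add_diff_cancel_right')
  qed
  also have "\<dots> = (\<Sum>i\<le>k. int (Suc k choose i) * ?S i)"
    by (subst sum.swap) (simp only: sum_distrib_left)
  also have "\<dots> = (\<Sum>i<k. int (Suc k choose i) * ?S i) + int (Suc k) * ?S k"
    by (simp flip: lessThan_Suc_atMost)
  finally have eq: "int (Suc k) * ?S k = int p ^ Suc k - (\<Sum>i<k. int (Suc k choose i) * ?S i)"
    by (simp only: add_diff_cancel_left')
  have "int p dvd (\<Sum>i<k. int (Suc k choose i) * ?S i)"
  proof (rule dvd_sum)
    fix i assume "i \<in> {..<k}"
    then have "int p dvd ?S i" using less.prems by (intro less.IH) auto
    then show "int p dvd int (Suc k choose i) * ?S i" by (rule dvd_mult)
  qed
  then have "int p dvd int (Suc k) * ?S k"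
    unfolding eq by (intro dvd_diff) auto
  moreover have "\<not> int p dvd int (Suc k)"
    using less.prems by (auto simp only: int_dvd_int_iff dest!: dvd_imp_le)
  ultimately show ?case using p prime_dvd_mult_iff[of "int p"] by simp
qed

text \<open>
  Modulo $p$ the exponent $j^{p-2}$ is the inverse of $j$, so that every factor
  $(1 - jg)^{j^{p-2}}$ has the logarithmic derivative $-g'/(1 - jg)$.
\<close>

definition char_p_exp :: "nat \<Rightarrow> 'a::comm_ring_1 \<Rightarrow> 'a" where
  "char_p_exp p g = (\<Prod>j\<in>{1..<p}. (1 - of_nat j * g) ^ (j ^ (p - 2)))"

text \<open>
  The logarithmic derivative is $-Dg \sum_{j=1}^{p-1} 1/(1 - jg)$. By Fermat
  $1 - g^{p-1} = 1 - (jg)^{p-1} = (1 - jg) S_j$ with a geometric sum $S_j$, so multiplication by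
  $1 - g^{p-1}$ clears the denominators and leaves $-\sum_j S_j = -\sum_k g^k \sum_j j^k$.
  The power sums vanish modulo $p$ except for $k = 0$, where the sum is $p - 1 = -1$.
\<close>

lemma char_p_exp_derivation:
  fixes D :: "'a::comm_ring_1 \<Rightarrow> 'a"
  assumes D: "\<And>a b. D (a + b) = D a + D b" "\<And>a b. D (a * b) = D a * b + a * D b"
    and p: "normalization_semidom_class.prime p" "of_nat p = (0::'a)"
  shows "(1 - g ^ (p - 1)) * D (char_p_exp p g) = char_p_exp p g * D g"
proof -
  let ?f = "\<lambda>j. 1 - of_nat j * g"
  let ?e = "\<lambda>j. j ^ (p - 2)"
  define S where "S j = (\<Sum>k<p - 1. (of_nat j * g) ^ k)" for j
  have p1: "p > 1" using p(1) prime_gt_1_nat by blast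
  have D0: "D 0 = 0" using D(1)[of 0 0] by simp
  have D1: "D 1 = 0" using D(2)[of 1 1] by simp
  have Dm: "D (- a) = - D a" for a using D(1)[of a "- a"] D0 by (simp add: eq_neg_iff_add_eq_0 add.commute)
  have Dn: "D (of_nat n) = 0" for n by (induction n) (simp_all add: D D0 D1)
  have Df: "D (?f j) = - (of_nat j * D g)" for j
    using D(1)[of 1 "- (of_nat j * g)"] by (simp add: D1 Dm D(2) Dn)
  have Dpow: "D (a ^ n) = of_nat n * a ^ (n - 1) * D a" for a n
  proof (induction n)
    case (Suc n)
    then show ?case by (cases n) (simp_all add: D(2) algebra_simps)
  qed (simp add: D1)
  have mod_p: "of_nat m = (of_nat n :: 'a)" if "[m = n] (mod p)" for m n
  proof -
    have "(of_nat (k div p * p + k mod p) :: 'a) = of_nat (k mod p)" for k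
      by (simp only: of_nat_add of_nat_mult p(2)) simp
    then have "(of_nat k :: 'a) = of_nat (k mod p)" for k
      by (simp only: div_mult_mod_eq)
    with that show ?thesis unfolding cong_def by metis
  qed
  have fermat: "(of_nat j :: 'a) ^ (p - 1) = 1" if "j \<in> {1..<p}" for j
  proof -
    have "\<not> p dvd j" using that by (auto dest: dvd_imp_le)
    then have "[j ^ (p - 1) = 1] (mod p)" using fermat_theorem[OF p(1)] by blast
    from mod_p[OF this] show ?thesis by simp
  qed
  have factor: "1 - g ^ (p - 1) = ?f j * S j" if "j \<in> {1..<p}" for j
  proof -
    have "1 - g ^ (p - 1) = 1 - (of_nat j * g) ^ (p - 1)"
      by (simp only: power_mult_distrib fermat[OF that] mult_1)
    also have "\<dots> = ?f j * S j" unfolding S_def by (rule one_diff_power_eq)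
    finally show ?thesis .
  qed
  have step: "(1 - g ^ (p - 1)) * D (?f j ^ ?e j) = - (S j * D g) * ?f j ^ ?e j"
    if j: "j \<in> {1..<p}" for j
  proof -
    have je: "(of_nat (?e j) :: 'a) * of_nat j = 1"
      using fermat[OF j] p1 power_Suc2[of "of_nat j :: 'a" "p - 2"] by (simp add: Suc_diff_Suc numeral_2_eq_2)
    have "?e j \<ge> 1" using j by simp
    then have pow: "?f j ^ ?e j = ?f j * ?f j ^ (?e j - 1)" by (metis Suc_diff_1 less_le_trans power_Suc zero_less_one)
    have "(1 - g ^ (p - 1)) * D (?f j ^ ?e j) =
        ?f j * S j * (of_nat (?e j) * ?f j ^ (?e j - 1) * (- (of_nat j * D g)))"
      unfolding factor[OF j] Dpow Df ..
    also have "\<dots> = - (of_nat (?e j) * of_nat j) * (S j * D g) * (?f j * ?f j ^ (?e j - 1))"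
      by (simp only: mult_minus_left mult_minus_right mult_ac)
    finally show ?thesis unfolding je pow[symmetric] by simp
  qed
  have "(1 - g ^ (p - 1)) * D (\<Prod>j\<in>A. ?f j ^ ?e j) =
      - (\<Sum>j\<in>A. S j) * D g * (\<Prod>j\<in>A. ?f j ^ ?e j)"
    if "finite A" "A \<subseteq> {1..<p}" for A
    using that
  proof (induction A)
    case (insert j A)
    let ?P = "\<Prod>j\<in>A. ?f j ^ ?e j"
    have "(1 - g ^ (p - 1)) * D (\<Prod>j\<in>insert j A. ?f j ^ ?e j) =
        (1 - g ^ (p - 1)) * D (?f j ^ ?e j) * ?P + ?f j ^ ?e j * ((1 - g ^ (p - 1)) * D ?P)"
      using insert by (simp add: D(2) algebra_simps)
    also have "\<dots> = - (S j + (\<Sum>j\<in>A. S j)) * D g * (?f j ^ ?e j * ?P)"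
    proof -
      have IH: "(1 - g ^ (p - 1)) * D ?P = - (\<Sum>j\<in>A. S j) * D g * ?P" and j: "j \<in> {1..<p}"
        using insert by auto
      show ?thesis unfolding step[OF j] IH by (simp add: algebra_simps)
    qed
    finally show ?case using insert by simp
  qed (simp add: D1)
  from this[of "{1..<p}"] have "(1 - g ^ (p - 1)) * D (char_p_exp p g) =
      - (\<Sum>j\<in>{1..<p}. S j) * D g * char_p_exp p g"
    by (simp add: char_p_exp_def)
  also have "(\<Sum>j\<in>{1..<p}. S j) = (\<Sum>k<p - 1. (\<Sum>j\<in>{1..<p}. of_nat j ^ k) * g ^ k)"
    unfolding S_def by (subst sum.swap) (simp only: power_mult_distrib sum_distrib_right)
  also have "\<dots> = (\<Sum>k<p - 1. if k = 0 then - 1 else 0)"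
  proof (rule sum.cong[OF refl])
    fix k assume k: "k \<in> {..<p - 1}"
    have split: "{..<p} = insert 0 {1..<p}" using p1 by auto
    obtain q where "(\<Sum>j<p. int j ^ k) = int p * q"
      using prime_dvd_power_sum[OF p(1), of k] k by (auto elim: dvdE)
    then have "(of_int (\<Sum>j<p. int j ^ k) :: 'a) = of_nat p * of_int q"
      by (simp only: of_int_mult of_int_of_nat_eq)
    then have "(\<Sum>j<p. (of_nat j :: 'a) ^ k) = 0" by (simp add: p(2))
    then have "(\<Sum>j\<in>{1..<p}. of_nat j ^ k) = - ((0::'a) ^ k)"
      unfolding split by (simp add: add_eq_0_iff)
    then show "(\<Sum>j\<in>{1..<p}. of_nat j ^ k) * g ^ k = (if k = 0 then - 1 else 0)"
      by (simp only:) (auto simp: power_0_left)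
  qed
  also have "\<dots> = - 1" using p1 by simp
  finally show ?thesis by (simp add: mult.commute)
qed

section \<open>Embeddings into the differential field\<close>

lemma zconst_simps [simp]:
  "zconst 0 = (0 :: 'k::comm_ring_1 zpoly)" "zconst 1 = (1 :: 'k zpoly)"
  "zconst (a + b) = zconst a + (zconst b :: 'k zpoly)" "zconst (a * b) = zconst a * (zconst b :: 'k zpoly)"
  by (simp_all add: zconst_def single_add mult_single)

lemma zconst_of_int: "zconst (of_int n) = (of_int n :: 'k::comm_ring_1 zpoly)"
  by (simp add: zconst_def)

lemma zconst_sum: "zconst (sum f A) = (\<Sum>a\<in>A. zconst (f a :: 'k::comm_ring_1))"
  by (induction A rule: infinite_finite_induct) simp_all

definition fps_zconst :: "'k::comm_ring_1 fps \<Rightarrow> 'k zpoly fps" where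
  "fps_zconst f = Abs_fps (\<lambda>n. zconst (fps_nth f n))"

lemma embed_fls_nth: "fls_nth (embed_fls a) n = to_fract (zconst (fls_nth a n))"
  unfolding embed_fls_def by (rule fls_map_nth) simp

lemma embed_fps_nth: "fls_nth (embed_fps y) n = (if n < 0 then 0 else to_fract (fps_nth y (nat n)))"
  by (simp add: embed_fps_def)

lemma embed_fps_zconst: "embed_fps (fps_zconst f) = embed_fls (fps_to_fls f)"
  by (intro fls_eqI) (simp add: embed_fps_nth embed_fls_nth fps_zconst_def)

lemma to_fract_sum: "to_fract (sum f A) = (\<Sum>a\<in>A. to_fract (f a))"
  by (induction A rule: infinite_finite_induct) simp_all

lemma to_fract_of_int: "to_fract (of_int n) = of_int n"
proof -
  have "to_fract (of_nat m) = of_nat m" for m by (induction m) simp_all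
  then show ?thesis by (cases n rule: int_cases2) simp_all
qed

lemma embed_fls_add: "embed_fls (a + b) = embed_fls a + embed_fls b"
  by (intro fls_eqI) (simp add: embed_fls_nth)

lemma embed_fls_mult: "embed_fls (a * b) = embed_fls a * embed_fls b"
proof -
  obtain N where N: "\<forall>n<N. fls_nth a n = 0" by (rule fls_nth_vanishes_belowE)
  obtain M where M: "\<forall>n<M. fls_nth b n = 0" by (rule fls_nth_vanishes_belowE)
  have N': "\<forall>n<N. fls_nth (embed_fls a) n = 0" using N by (simp add: embed_fls_nth)
  have M': "\<forall>n<M. fls_nth (embed_fls b) n = 0" using M by (simp add: embed_fls_nth)
  show ?thesis
    by (intro fls_eqI)
       (simp add: embed_fls_nth fls_times_nth_bounded[OF N M] fls_times_nth_bounded[OF N' M']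
         zconst_sum to_fract_sum)
qed

lemma embed_fls_const: "embed_fls (fls_const c) = fls_const (to_fract (zconst c))"
  unfolding embed_fls_def by (rule fls_map_const) simp

lemma embed_fls_1: "embed_fls 1 = 1"
  using embed_fls_const[of 1] by simp

lemma embed_fls_X: "embed_fls fls_X = fls_X"
  by (intro fls_eqI) (simp add: embed_fls_nth)

lemma zlaurent_deriv_embed_fls: "zlaurent_deriv (embed_fls a) = embed_fls (fls_deriv a)"
proof (rule fls_eqI)
  fix n
  have "to_fract (zconst (of_int (n + 1) * fls_nth a (n + 1))) =
      of_int (n + 1) * to_fract (zconst (fls_nth a (n + 1)))"
    by (simp only: zconst_simps zconst_of_int to_fract_mult) (simp add: to_fract_of_int)
  then show "fls_nth (zlaurent_deriv (embed_fls a)) n = fls_nth (embed_fls (fls_deriv a)) n"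
    by (simp only: zlaurent_deriv_nth embed_fls_nth zfrac_deriv_to_fract zpoly_deriv_const fls_deriv_nth add_0)
qed

lemma embed_fps_add: "embed_fps (f + g) = embed_fps f + embed_fps g"
  by (intro fls_eqI) (simp add: embed_fps_nth)

lemma embed_fps_1: "embed_fps 1 = 1"
  by (intro fls_eqI) (simp add: embed_fps_nth)

lemma embed_fps_mult: "embed_fps (f * g) = embed_fps f * embed_fps g"
proof -
  have "Abs_fps (\<lambda>n. to_fract (fps_nth (f * g) n)) =
      Abs_fps (\<lambda>n. to_fract (fps_nth f n)) * Abs_fps (\<lambda>n. to_fract (fps_nth g n))"
    by (intro fps_ext) (simp add: fps_mult_nth to_fract_sum)
  then show ?thesis by (simp add: embed_fps_def fls_times_fps_to_fls)
qed

lemma embed_fps_eq_iff: "embed_fps f = embed_fps g \<longleftrightarrow> f = g"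
proof
  assume "embed_fps f = embed_fps g"
  then have "to_fract (fps_nth f n) = to_fract (fps_nth g n)" for n
    using embed_fps_nth[of f "int n"] embed_fps_nth[of g "int n"] by simp
  then show "f = g" by (intro fps_ext) simp
qed simp

lemma embed_fps_0: "embed_fps 0 = 0"
  by (intro fls_eqI) (simp add: embed_fps_nth)

lemma embed_fps_diff: "embed_fps (f - g) = embed_fps f - embed_fps g"
  using embed_fps_add[of "f - g" g] by (simp add: algebra_simps)

lemma embed_fps_power: "embed_fps (f ^ n) = embed_fps f ^ n"
  by (induction n) (simp_all add: embed_fps_mult embed_fps_1)

lemma embed_fps_prod: "embed_fps (prod f A) = (\<Prod>a\<in>A. embed_fps (f a))"
  by (induction A rule: infinite_finite_induct) (simp_all add: embed_fps_mult embed_fps_1)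

lemma embed_fps_of_nat: "embed_fps (of_nat n) = of_nat n"
  by (induction n) (simp_all add: embed_fps_add embed_fps_1 embed_fps_0)

lemma embed_fps_const: "embed_fps (fps_const c) = fls_const (to_fract c)"
  by (intro fls_eqI) (simp add: embed_fps_nth)

lemma embed_fps_char_p_exp: "embed_fps (char_p_exp p g) = char_p_exp p (embed_fps g)"
  by (simp add: char_p_exp_def embed_fps_prod embed_fps_power embed_fps_diff embed_fps_1
      embed_fps_mult embed_fps_of_nat)

lemma embed_fls_0: "embed_fls 0 = 0"
  by (intro fls_eqI) (simp add: embed_fls_nth)

lemma embed_fls_diff: "embed_fls (a - b) = embed_fls a - embed_fls b"
  using embed_fls_add[of "a - b" b] by (simp add: algebra_simps)

lemma embed_fls_inverse: "embed_fls (inverse a) = inverse (embed_fls a)"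
proof (cases "a = 0")
  case False
  then have "embed_fls a * embed_fls (inverse a) = 1"
    by (simp add: embed_fls_1 flip: embed_fls_mult)
  then show ?thesis by (metis inverse_unique)
qed (simp add: embed_fls_0)

lemma is_subfield_zrat_funs: "is_subfield (zrat_funs i)"
  unfolding zrat_funs_def by (rule is_subfield_hull)

lemma zrat_funs_mono: "i \<le> j \<Longrightarrow> zrat_funs i \<subseteq> zrat_funs j"
  unfolding zrat_funs_def by (intro hull_mono) auto

lemma z_in_zrat_funs: "j \<le> i \<Longrightarrow> fls_const (to_fract (z j)) \<in> zrat_funs i"
proof (cases "j = 0")
  case True
  then show ?thesis using is_subfield_1[OF is_subfield_zrat_funs] by (simp add: z_def)
next
  case False
  moreover assume "j \<le> i"
  ultimately show ?thesis unfolding zrat_funs_def by (intro hull_inc) auto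
qed

lemma embed_fls_rat_funs: "embed_fls ` rat_funs \<subseteq> zrat_funs i"
proof (rule image_subsetI)
  fix q :: "'a fls"
  assume q: "q \<in> rat_funs"
  have K: "is_subfield (zrat_funs i :: 'a zlaurent set)" by (rule is_subfield_zrat_funs)
  have "q \<in> {q. embed_fls q \<in> zrat_funs i}"
  proof (rule rat_funs_induct[OF q])
    show "is_subfield {q :: 'a fls. embed_fls q \<in> zrat_funs i}"
      unfolding is_subfield_def
      by (auto simp: embed_fls_1 embed_fls_diff embed_fls_mult embed_fls_inverse is_subfield_closed[OF K])
    show "fls_const c \<in> {q :: 'a fls. embed_fls q \<in> zrat_funs i}" for c
      unfolding zrat_funs_def by (auto simp: embed_fls_const intro!: hull_inc)
    show "fls_X \<in> {q :: 'a fls. embed_fls q \<in> zrat_funs i}"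
      unfolding zrat_funs_def by (auto simp: embed_fls_X intro!: hull_inc)
  qed
  then show "embed_fls q \<in> zrat_funs i" by simp
qed

lemma algebraic_over_zrat_funs_zconst:
  assumes "algebraic_over rat_funs (fps_to_fls f)"
  shows "algebraic_over (zrat_funs i) (embed_fps (fps_zconst f))"
  unfolding embed_fps_zconst
  by (rule algebraic_over_image[OF embed_fls_1 embed_fls_add embed_fls_mult embed_fls_rat_funs assms])

section \<open>Setting variables to zero\<close>

lemma zsubst_superset:
  assumes "finite S" "Poly_Mapping.keys f \<subseteq> S"
  shows "zsubst s f = (\<Sum>m\<in>S. zconst (Poly_Mapping.lookup f m) *
     (\<Prod>j\<in>Poly_Mapping.keys m. s (Suc j) ^ Poly_Mapping.lookup m j))"
  unfolding zsubst_def using assms by (intro sum.mono_neutral_left) (auto simp: in_keys_iff)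

lemma zsubst_add: "zsubst s (f + g) = zsubst s f + zsubst s g"
proof -
  let ?S = "Poly_Mapping.keys f \<union> Poly_Mapping.keys g"
  have "Poly_Mapping.keys (f + g) \<subseteq> ?S" by (rule Poly_Mapping.keys_add)
  then show ?thesis
    by (subst (1 2 3) zsubst_superset[of ?S])
       (auto simp: lookup_add distrib_right sum.distrib)
qed

lemma zsubst_0 [simp]: "zsubst s 0 = 0"
  by (simp add: zsubst_def)

lemma zsubst_sum: "zsubst s (sum f A) = (\<Sum>a\<in>A. zsubst s (f a))"
  by (induction A rule: infinite_finite_induct) (simp_all add: zsubst_add)

lemma zsubst_single:
  "zsubst s (Poly_Mapping.single m c) =
     zconst c * (\<Prod>j\<in>Poly_Mapping.keys m. s (Suc j) ^ Poly_Mapping.lookup m j)"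
  by (subst zsubst_superset[of "{m}"]) auto

lemma zsubst_mult_single:
  "zsubst s (Poly_Mapping.single m c * Poly_Mapping.single n d) =
     zsubst s (Poly_Mapping.single m c) * zsubst s (Poly_Mapping.single n d)"
proof -
  let ?S = "Poly_Mapping.keys m \<union> Poly_Mapping.keys n"
  have *: "(\<Prod>j\<in>Poly_Mapping.keys l. s (Suc j) ^ Poly_Mapping.lookup l j) =
      (\<Prod>j\<in>?S. s (Suc j) ^ Poly_Mapping.lookup l j)" if "Poly_Mapping.keys l \<subseteq> ?S" for l
    using that by (intro prod.mono_neutral_left) (auto simp: in_keys_iff)
  have "zsubst s (Poly_Mapping.single m c * Poly_Mapping.single n d) =
      zconst c * zconst d * (\<Prod>j\<in>?S. s (Suc j) ^ Poly_Mapping.lookup (m + n) j)"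
    by (simp only: mult_single zsubst_single zconst_simps *[OF Poly_Mapping.keys_add])
  also have "\<dots> = zconst c * (\<Prod>j\<in>?S. s (Suc j) ^ Poly_Mapping.lookup m j) *
      (zconst d * (\<Prod>j\<in>?S. s (Suc j) ^ Poly_Mapping.lookup n j))"
    by (simp add: lookup_add power_add prod.distrib mult_ac)
  finally show ?thesis by (simp add: zsubst_single *)
qed

lemma zsubst_mult: "zsubst s (f * g) = zsubst s f * zsubst s g"
proof (induction f rule: zpoly_induct)
  case (add f m c)
  have "zsubst s (Poly_Mapping.single m c * g) = zsubst s (Poly_Mapping.single m c) * zsubst s g"
    by (induction g rule: zpoly_induct)
       (simp_all add: zsubst_add zsubst_mult_single distrib_left)
  with add show ?case by (simp add: zsubst_add distrib_right)
qed simp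

lemma zsubst_1: "zsubst s 1 = 1"
  using zsubst_single[of s 0 1] by simp

lemma zsubst_z:
  assumes "i \<ge> 1" shows "zsubst s (z i) = s i"
  using assms by (simp add: z_def zsubst_single)

lemma sum_single_lookup:
  "(\<Sum>m\<in>Poly_Mapping.keys f. Poly_Mapping.single m (Poly_Mapping.lookup f m)) = f"
  by (intro poly_mapping_eqI)
     (auto simp: lookup_sum lookup_single when_def in_keys_iff)

lemma zsubst_ident:
  assumes "\<And>j. j \<in> zpositions f \<Longrightarrow> s (Suc j) = z (Suc j)"
  shows "zsubst s f = f"
proof -
  have monom: "(\<Prod>j\<in>A. z (Suc j) ^ Poly_Mapping.lookup m j) =
      (Poly_Mapping.single (\<Sum>j\<in>A. Poly_Mapping.single j (Poly_Mapping.lookup m j)) 1 :: 'a zpoly)"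
    if "finite A" for A m
    using that
  proof (induction A)
    case (insert j A)
    have "z (Suc j) ^ n = (Poly_Mapping.single (Poly_Mapping.single j n) 1 :: 'a zpoly)" for n
      by (induction n) (simp_all add: z_def mult_single flip: single_add)
    with insert show ?case by (simp add: mult_single)
  qed simp
  have "zsubst s f = (\<Sum>m\<in>Poly_Mapping.keys f. Poly_Mapping.single m (Poly_Mapping.lookup f m))"
    unfolding zsubst_def
  proof (rule sum.cong[OF refl])
    fix m assume m: "m \<in> Poly_Mapping.keys f"
    have "(\<Prod>j\<in>Poly_Mapping.keys m. s (Suc j) ^ Poly_Mapping.lookup m j) =
        (\<Prod>j\<in>Poly_Mapping.keys m. z (Suc j) ^ Poly_Mapping.lookup m j)"
    proof (rule prod.cong[OF refl])
      fix j assume "j \<in> Poly_Mapping.keys m"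
      with m have "j \<in> zpositions f" by (auto simp: zpositions_def)
      then show "s (Suc j) ^ Poly_Mapping.lookup m j = z (Suc j) ^ Poly_Mapping.lookup m j"
        using assms by simp
    qed
    also have "\<dots> = Poly_Mapping.single m 1"
      by (simp add: monom sum_single_lookup)
    finally show "zconst (Poly_Mapping.lookup f m) *
        (\<Prod>j\<in>Poly_Mapping.keys m. s (Suc j) ^ Poly_Mapping.lookup m j) =
        Poly_Mapping.single m (Poly_Mapping.lookup f m)"
      by (simp add: zconst_def mult_single)
  qed
  then show ?thesis by (simp add: sum_single_lookup)
qed

lemma zproj_add: "zproj i (f + g) = zproj i f + zproj i g"
  by (intro fps_ext) (simp add: zproj_def zsubst_add)

lemma zproj_mult: "zproj i (f * g) = zproj i f * zproj i g"
  by (intro fps_ext) (simp add: zproj_def fps_mult_nth zsubst_sum zsubst_mult)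

lemma zproj_1: "zproj i 1 = 1"
  by (intro fps_ext) (simp add: zproj_def zsubst_1)

lemma zproj_prod: "zproj i (prod f A) = (\<Prod>a\<in>A. zproj i (f a))"
  by (induction A rule: infinite_finite_induct) (simp_all add: zproj_mult zproj_1)

section \<open>Series in the first variables\<close>

lemma zpolys_upto_mono: "i \<le> j \<Longrightarrow> zpolys_upto i \<subseteq> zpolys_upto j"
  by (auto simp: zpolys_upto_def)

lemma zconst_in_zpolys_upto: "zconst c \<in> zpolys_upto i"
  by (auto simp: zpolys_upto_def zpositions_def zconst_def split: if_splits)

lemma z_in_zpolys_upto: "j \<le> i \<Longrightarrow> z j \<in> zpolys_upto i"
  by (auto simp: zpolys_upto_def zpositions_def z_def)

lemma zpolys_upto_add: "f \<in> zpolys_upto i \<Longrightarrow> g \<in> zpolys_upto i \<Longrightarrow> f + g \<in> zpolys_upto i"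
  using Poly_Mapping.keys_add[of f g] unfolding zpolys_upto_def zpositions_def by blast

lemma zpolys_upto_mult:
  fixes f g :: "'k::comm_ring_1 zpoly"
  assumes "f \<in> zpolys_upto i" "g \<in> zpolys_upto i" shows "f * g \<in> zpolys_upto i"
proof -
  have "Poly_Mapping.keys m \<subseteq> {..<i}" if "m \<in> Poly_Mapping.keys (f * g)" for m
  proof -
    obtain a b where ab: "m = a + b" "a \<in> Poly_Mapping.keys f" "b \<in> Poly_Mapping.keys g"
      using Poly_Mapping.keys_mult[of f g] \<open>m \<in> _\<close> by blast
    have "Poly_Mapping.keys m \<subseteq> Poly_Mapping.keys a \<union> Poly_Mapping.keys b"
      unfolding ab(1) by (rule Poly_Mapping.keys_add)
    then show ?thesis using assms ab(2,3) by (fastforce simp: zpolys_upto_def zpositions_def)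
  qed
  then show ?thesis by (auto simp: zpolys_upto_def zpositions_def)
qed

lemma zpolys_upto_0: "(0 :: 'k::comm_ring_1 zpoly) \<in> zpolys_upto i"
  and zpolys_upto_1: "(1 :: 'k zpoly) \<in> zpolys_upto i"
  using zconst_in_zpolys_upto[of "0::'k" i] zconst_in_zpolys_upto[of "1::'k" i] by simp_all

lemma zpolys_upto_power: "f \<in> zpolys_upto i \<Longrightarrow> f ^ n \<in> zpolys_upto i"
  for f :: "'k::comm_ring_1 zpoly"
  by (induction n) (simp_all add: zpolys_upto_1 zpolys_upto_mult)

lemma zpolys_upto_sum: "(\<And>a. a \<in> A \<Longrightarrow> f a \<in> zpolys_upto i) \<Longrightarrow> sum f A \<in> zpolys_upto i"
  for f :: "_ \<Rightarrow> 'k::comm_ring_1 zpoly"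
  by (induction A rule: infinite_finite_induct) (simp_all add: zpolys_upto_0 zpolys_upto_add)

lemma zpolys_upto_uminus: "f \<in> zpolys_upto i \<Longrightarrow> - f \<in> zpolys_upto i"
  for f :: "'k::comm_ring_1 zpoly"
  by (simp add: zpolys_upto_def zpositions_def Poly_Mapping.keys_def lookup_uminus)

definition zseries_upto :: "nat \<Rightarrow> 'k::comm_ring_1 zpoly fps set" where
  "zseries_upto i = {f. \<forall>n. fps_nth f n \<in> zpolys_upto i}"

lemma zseries_upto_add: "f \<in> zseries_upto i \<Longrightarrow> g \<in> zseries_upto i \<Longrightarrow> f + g \<in> zseries_upto i"
  by (simp add: zseries_upto_def zpolys_upto_add)

lemma zseries_upto_uminus: "f \<in> zseries_upto i \<Longrightarrow> - f \<in> zseries_upto i"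
  by (simp add: zseries_upto_def zpolys_upto_uminus)

lemma zseries_upto_mult: "f \<in> zseries_upto i \<Longrightarrow> g \<in> zseries_upto i \<Longrightarrow> f * g \<in> zseries_upto i"
  by (auto simp: zseries_upto_def fps_mult_nth intro!: zpolys_upto_sum zpolys_upto_mult)

lemma zseries_upto_const: "c \<in> zpolys_upto i \<Longrightarrow> fps_const c \<in> zseries_upto i"
  by (simp add: zseries_upto_def zpolys_upto_0)

lemma zseries_upto_of_nat: "(of_nat n :: 'k::comm_ring_1 zpoly fps) \<in> zseries_upto i"
proof (induction n)
  case (Suc n)
  have "fps_const (1 :: 'k zpoly) \<in> zseries_upto i" by (intro zseries_upto_const zpolys_upto_1)
  with Suc show ?case by (simp add: zseries_upto_add)
qed (simp add: zseries_upto_def zpolys_upto_0)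

lemma zseries_upto_X: "fps_X \<in> zseries_upto i"
  by (simp add: zseries_upto_def zpolys_upto_0 zpolys_upto_1)

lemma zseries_upto_power: "f \<in> zseries_upto i \<Longrightarrow> f ^ n \<in> zseries_upto i"
proof (induction n)
  case 0
  show ?case using zseries_upto_of_nat[of 1 i] by simp
qed (simp add: zseries_upto_mult)

lemma zseries_upto_mono: "i \<le> j \<Longrightarrow> zseries_upto i \<subseteq> zseries_upto j"
  using zpolys_upto_mono[of i j] by (auto simp: zseries_upto_def)

text \<open>
  The sets $1 + m\,k[z_1,\ldots,z_i][[x]]$. They are closed under multiplication, which is how
  the required shape of the factors survives the product defining \<open>char_p_exp\<close>.
\<close>

definition one_plus_multiples :: "nat \<Rightarrow> 'k::comm_ring_1 zpoly fps \<Rightarrow> 'k zpoly fps set" where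
  "one_plus_multiples i m = {f. \<exists>g\<in>zseries_upto i. f = 1 + m * g}"

lemma one_plus_multiples_mult:
  assumes "m \<in> zseries_upto i" "f \<in> one_plus_multiples i m" "f' \<in> one_plus_multiples i m"
  shows "f * f' \<in> one_plus_multiples i m"
proof -
  obtain g g' where g: "g \<in> zseries_upto i" "g' \<in> zseries_upto i" "f = 1 + m * g" "f' = 1 + m * g'"
    using assms by (auto simp: one_plus_multiples_def)
  have "f * f' = 1 + m * (g + g' + m * (g * g'))" by (simp add: g algebra_simps)
  moreover have "g + g' + m * (g * g') \<in> zseries_upto i"
    using g assms(1) by (intro zseries_upto_add zseries_upto_mult)
  ultimately show ?thesis unfolding one_plus_multiples_def by blast
qed

lemma one_plus_multiples_1: "1 \<in> one_plus_multiples i m"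
  using zseries_upto_of_nat[of 0 i] by (auto simp: one_plus_multiples_def intro!: bexI[of _ 0])

lemma char_p_exp_one_plus_multiples:
  assumes m: "m \<in> zseries_upto i" and g: "g \<in> zseries_upto i"
  shows "char_p_exp p (m * g) \<in> one_plus_multiples i m"
proof -
  have "1 - of_nat j * (m * g) \<in> one_plus_multiples i m" for j
  proof -
    have "- (of_nat j * g) \<in> zseries_upto i"
      by (intro zseries_upto_uminus zseries_upto_mult zseries_upto_of_nat g)
    moreover have "1 - of_nat j * (m * g) = 1 + m * (- (of_nat j * g))" by (simp add: algebra_simps)
    ultimately show ?thesis unfolding one_plus_multiples_def by blast
  qed
  then have pow: "(1 - of_nat j * (m * g)) ^ k \<in> one_plus_multiples i m" for j k
    by (induction k) (simp_all add: one_plus_multiples_1 one_plus_multiples_mult[OF m])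
  have "(\<Prod>j\<in>A. (1 - of_nat j * (m * g)) ^ e j) \<in> one_plus_multiples i m" for A and e :: "nat \<Rightarrow> nat"
    by (induction A rule: infinite_finite_induct)
       (simp_all add: one_plus_multiples_1 one_plus_multiples_mult[OF m] pow)
  then show ?thesis by (simp add: char_p_exp_def)
qed

section \<open>The tower of Artin-Schreier equations\<close>

text \<open>
  The residual $c_i$ is the $\theta$-constant for which $c_i/(z_1\cdots z_i)$ is what
  the factors up to $h_i$ leave of the logarithmic derivative. The series $G_i$ with
  $G_i - G_i^p = c_i z_{i+1}$ is the argument of the next factor, and $c_{i+1} = -G_i^p$.
\<close>

primrec tower_residual :: "'p::prime_card mod_ring fps \<Rightarrow> nat \<Rightarrow> 'p mod_ring zpoly fps" where
  "tower_residual c 0 = fps_zconst c"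
| "tower_residual c (Suc i) =
     - (artin_schreier (fps_const (z (Suc i)) * tower_residual c i) ^ CARD('p))"

definition tower_log :: "'p::prime_card mod_ring fps \<Rightarrow> nat \<Rightarrow> 'p mod_ring zpoly fps" where
  "tower_log c i = artin_schreier (fps_const (z (Suc i)) * tower_residual c i)"

lemma tower_residual_Suc: "tower_residual c (Suc i) = - (tower_log c i ^ CARD('p))"
  for c :: "'p::prime_card mod_ring fps"
  by (simp add: tower_log_def)

lemma tower_residual_nth_eq_0:
  fixes c :: "'p::prime_card mod_ring fps"
  assumes "\<And>n. n < CARD('p) \<Longrightarrow> fps_nth c n = 0"
  shows "n < CARD('p) ^ Suc i \<Longrightarrow> fps_nth (tower_residual c i) n = 0"
    and "n < CARD('p) ^ Suc i \<Longrightarrow> fps_nth (tower_log c i) n = 0"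
proof -
  let ?p = "CARD('p)"
  have p1: "1 < ?p" using prime_card[where ?'a = 'p] prime_gt_1_nat by blast
  have log: "fps_nth (tower_log c i) n = 0"
    if "\<And>n. n < ?p ^ Suc i \<Longrightarrow> fps_nth (tower_residual c i) n = 0" "n < ?p ^ Suc i" for i n
    unfolding tower_log_def by (rule artin_schreier_nth_eq_0[OF _ that(2)]) (use that(1) in simp)
  have res: "n < ?p ^ Suc i \<Longrightarrow> fps_nth (tower_residual c i) n = 0" for i n
  proof (induction i arbitrary: n)
    case 0
    then show ?case using assms by (simp add: fps_zconst_def)
  next
    case (Suc i)
    then have "n div ?p < ?p ^ Suc i" by (simp add: div_less_iff_less_mult mult.commute)
    then have "fps_nth (tower_log c i) (n div ?p) = 0" using log Suc.IH by blast
    then show ?case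
      using fps_power_char_nth[of "tower_log c i" n] p1
      by (simp add: tower_residual_Suc power_0_left del: tower_residual.simps)
  qed
  show "n < CARD('p) ^ Suc i \<Longrightarrow> fps_nth (tower_residual c i) n = 0"
    and "n < CARD('p) ^ Suc i \<Longrightarrow> fps_nth (tower_log c i) n = 0"
    using res log by blast+
qed

lemma tower_log_diff_power:
  fixes c :: "'p::prime_card mod_ring fps"
  assumes "\<And>n. n < CARD('p) \<Longrightarrow> fps_nth c n = 0"
  shows "tower_log c i - tower_log c i ^ CARD('p) = fps_const (z (Suc i)) * tower_residual c i"
proof -
  have "fps_nth (tower_residual c i) 0 = 0"
    by (rule tower_residual_nth_eq_0(1)[OF assms]) simp_all
  then have "fps_nth (fps_const (z (Suc i)) * tower_residual c i) 0 = 0" by simp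
  from artin_schreier_diff_power[OF this] show ?thesis by (simp add: tower_log_def)
qed

text \<open>
  The multiples of $z_{i+1}$ in $k[z_1,\ldots,z_{i+1}]$ are closed under addition and $p$-th
  powers, so the coefficients of $G_i$ are such multiples.
\<close>

lemma tower_log_nth_multiple:
  fixes c :: "'p::prime_card mod_ring fps"
  shows "tower_residual c i \<in> zseries_upto i"
    and "\<exists>g\<in>zpolys_upto (Suc i). fps_nth (tower_log c i) n = z (Suc i) * g"
proof -
  let ?S = "\<lambda>i. {f. \<exists>g\<in>zpolys_upto (Suc i). f = z (Suc i) * (g :: 'p mod_ring zpoly)}"
  have p1: "1 < CARD('p)" using prime_card[where ?'a = 'p] prime_gt_1_nat by blast
  have zS: "z (Suc i) \<in> zpolys_upto (Suc i)" for i by (rule z_in_zpolys_upto) simp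
  have log: "fps_nth (tower_log c i) n \<in> ?S i" if res: "tower_residual c i \<in> zseries_upto i" for i n
    unfolding tower_log_def
  proof (rule artin_schreier_nth_in)
    fix n
    have "fps_nth (tower_residual c i) n \<in> zpolys_upto (Suc i)"
      using res zpolys_upto_mono[of i "Suc i"] by (auto simp: zseries_upto_def)
    then show "fps_nth (fps_const (z (Suc i)) * tower_residual c i) n \<in> ?S i" by auto
  next
    fix a b assume "a \<in> ?S i" "b \<in> ?S i"
    then obtain g h where gh: "g \<in> zpolys_upto (Suc i)" "h \<in> zpolys_upto (Suc i)"
      "a = z (Suc i) * g" "b = z (Suc i) * h" by blast
    then have "a + b = z (Suc i) * (g + h)" by (simp add: distrib_left)
    then show "a + b \<in> ?S i" using zpolys_upto_add[OF gh(1,2)] by blast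
  next
    fix a assume "a \<in> ?S i"
    then obtain g where g: "g \<in> zpolys_upto (Suc i)" "a = z (Suc i) * g" by blast
    have "a ^ CARD('p) = z (Suc i) * (g * (z (Suc i) * g) ^ (CARD('p) - 1))"
      using p1 power_Suc[of a "CARD('p) - 1"] by (simp add: g(2) mult.assoc)
    then show "a ^ CHAR('p mod_ring zpoly) \<in> ?S i"
      using g(1) zS by (auto intro!: zpolys_upto_mult zpolys_upto_power)
  qed
  have res: "tower_residual c i \<in> zseries_upto i" for i
  proof (induction i)
    case 0
    show ?case by (simp add: zseries_upto_def fps_zconst_def zconst_in_zpolys_upto)
  next
    case (Suc i)
    have "fps_nth (tower_log c i) n \<in> zpolys_upto (Suc i)" for n
      using log[OF Suc, of n] by (auto intro!: zpolys_upto_mult zS)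
    then have "tower_log c i \<in> zseries_upto (Suc i)" by (simp add: zseries_upto_def)
    then show ?case
      unfolding tower_residual_Suc by (intro zseries_upto_uminus zseries_upto_power)
  qed
  show "tower_residual c i \<in> zseries_upto i" by (rule res)
  show "\<exists>g\<in>zpolys_upto (Suc i). fps_nth (tower_log c i) n = z (Suc i) * g"
    using log[OF res] by blast
qed

lemma tower_log_multiple:
  fixes c :: "'p::prime_card mod_ring fps"
  assumes "\<And>n. n < CARD('p) \<Longrightarrow> fps_nth c n = 0"
  shows "\<exists>g\<in>zseries_upto (Suc i). tower_log c i = fps_X ^ (CARD('p) ^ Suc i) * fps_const (z (Suc i)) * g"
proof -
  let ?N = "CARD('p) ^ Suc i"
  obtain g where g: "\<And>n. g n \<in> zpolys_upto (Suc i)" "\<And>n. fps_nth (tower_log c i) n = z (Suc i) * g n"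
    using tower_log_nth_multiple(2)[of i c] by metis
  have "tower_log c i = fps_X ^ ?N * (fps_const (z (Suc i)) * Abs_fps (\<lambda>n. g (n + ?N)))"
  proof (rule fps_ext)
    show "fps_nth (tower_log c i) n =
        fps_nth (fps_X ^ ?N * (fps_const (z (Suc i)) * Abs_fps (\<lambda>n. g (n + ?N)))) n" for n
    proof (cases "n < ?N")
      case True
      then show ?thesis
        using tower_residual_nth_eq_0(2)[OF assms True] by (simp add: fps_X_power_mult_nth del: power_Suc)
    next
      case False
      then show ?thesis by (simp add: fps_X_power_mult_nth g(2) del: power_Suc)
    qed
  qed
  then show ?thesis using g(1)
    by (intro bexI[of _ "Abs_fps (\<lambda>n. g (n + ?N))"]) (auto simp: zseries_upto_def mult.assoc simp del: power_Suc)
qed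

lemma tower_algebraic:
  fixes c :: "'p::prime_card mod_ring fps"
  assumes c: "\<And>n. n < CARD('p) \<Longrightarrow> fps_nth c n = 0"
    and alg: "algebraic_over rat_funs (fps_to_fls c)"
  shows "algebraic_over (zrat_funs i) (embed_fps (tower_residual c i))"
    and "algebraic_over (zrat_funs (Suc i)) (embed_fps (tower_log c i))"
proof -
  let ?A = "\<lambda>i. {f :: 'p mod_ring zlaurent. algebraic_over (zrat_funs i) f}"
  have p1: "1 < CARD('p)" using prime_card[where ?'a = 'p] prime_gt_1_nat by blast
  have A: "is_subfield (?A i)" for i by (rule is_subfield_algebraic_over[OF is_subfield_zrat_funs])
  have log: "embed_fps (tower_log c i) \<in> ?A (Suc i)" if "embed_fps (tower_residual c i) \<in> ?A i" for i
  proof -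
    have "embed_fps (tower_residual c i) \<in> ?A (Suc i)"
      using that algebraic_over_mono zrat_funs_mono[of i "Suc i"] by auto
    moreover have "fls_const (to_fract (z (Suc i))) \<in> ?A (Suc i)"
      using algebraic_over_self[OF is_subfield_zrat_funs z_in_zrat_funs] by auto
    ultimately have "embed_fps (fps_const (z (Suc i)) * tower_residual c i) \<in> ?A (Suc i)"
      by (simp only: embed_fps_mult embed_fps_const is_subfield_mult[OF A])
    then have "algebraic_over (zrat_funs (Suc i))
        (embed_fps (tower_log c i) - embed_fps (tower_log c i) ^ CARD('p))"
      using tower_log_diff_power[OF c, of i] by (simp flip: embed_fps_power embed_fps_diff)
    then show ?thesis
      using algebraic_over_artin_schreier_root[OF is_subfield_zrat_funs p1] by blast
  qed
  have res: "embed_fps (tower_residual c i) \<in> ?A i" for i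
  proof (induction i)
    case 0
    show ?case using algebraic_over_zrat_funs_zconst[OF alg] by simp
  next
    case (Suc i)
    have "embed_fps (tower_residual c (Suc i)) = 0 - embed_fps (tower_log c i) ^ CARD('p)"
      unfolding tower_residual_Suc
      using embed_fps_diff[of 0 "tower_log c i ^ CARD('p)"] by (simp add: embed_fps_power embed_fps_0)
    then show ?case using log[OF Suc] by (simp only: is_subfield_closed[OF A])
  qed
  show "algebraic_over (zrat_funs i) (embed_fps (tower_residual c i))"
    and "algebraic_over (zrat_funs (Suc i)) (embed_fps (tower_log c i))"
    using res log by blast+
qed

fun tower_factor :: "'p::prime_card mod_ring fps \<Rightarrow> 'p mod_ring fps \<Rightarrow> nat \<Rightarrow> 'p mod_ring zpoly fps" where
  "tower_factor h c 0 = fps_zconst h"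
| "tower_factor h c (Suc i) = char_p_exp CARD('p) (tower_log c i)"

lemma tower_factor_form:
  fixes h c :: "'p::prime_card mod_ring fps"
  assumes h: "fps_nth h 0 = 1" and c: "\<And>n. n < CARD('p) \<Longrightarrow> fps_nth c n = 0"
  shows "\<exists>g. (\<forall>n. fps_nth g n \<in> zpolys_upto i) \<and>
    tower_factor h c i = 1 + fps_X ^ (CARD('p) ^ i) * fps_const (z i) * g"
proof (cases i)
  case 0
  have "tower_factor h c 0 = 1 + fps_X * fps_zconst (fps_shift 1 h)"
    by (intro fps_ext) (auto simp: fps_zconst_def h)
  then show ?thesis
    using 0 by (intro exI[of _ "fps_zconst (fps_shift 1 h)"])
      (auto simp: fps_zconst_def zconst_in_zpolys_upto z_def)
next
  case (Suc j)
  let ?m = "fps_X ^ (CARD('p) ^ Suc j) * fps_const (z (Suc j)) :: 'p mod_ring zpoly fps"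
  obtain g where g: "g \<in> zseries_upto (Suc j)" "tower_log c j = ?m * g"
    using tower_log_multiple[OF c] by blast
  have "?m \<in> zseries_upto (Suc j)"
    by (intro zseries_upto_mult zseries_upto_power zseries_upto_X zseries_upto_const z_in_zpolys_upto) simp
  then have "char_p_exp CARD('p) (?m * g) \<in> one_plus_multiples (Suc j) ?m"
    using g(1) by (rule char_p_exp_one_plus_multiples)
  then show ?thesis
    unfolding Suc tower_factor.simps g(2) by (auto simp: one_plus_multiples_def zseries_upto_def)
qed

lemma char_p_exp_in_subfield:
  "is_subfield K \<Longrightarrow> g \<in> K \<Longrightarrow> char_p_exp p g \<in> K"
  unfolding char_p_exp_def by (intro is_subfield_closed) auto

lemma tower_factor_algebraic:
  fixes h c :: "'p::prime_card mod_ring fps"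
  assumes c: "\<And>n. n < CARD('p) \<Longrightarrow> fps_nth c n = 0"
    and alg: "algebraic_over rat_funs (fps_to_fls h)" "algebraic_over rat_funs (fps_to_fls c)"
  shows "algebraic_over (zrat_funs i) (embed_fps (tower_factor h c i))"
proof (cases i)
  case 0
  then show ?thesis using algebraic_over_zrat_funs_zconst[OF alg(1)] by simp
next
  case (Suc j)
  have "is_subfield {f :: 'p mod_ring zlaurent. algebraic_over (zrat_funs i) f}"
    by (rule is_subfield_algebraic_over[OF is_subfield_zrat_funs])
  from char_p_exp_in_subfield[OF this] show ?thesis
    using tower_algebraic(2)[OF c alg(2), of j] by (simp add: Suc embed_fps_char_p_exp)
qed

section \<open>Logarithmic derivatives of the factors\<close>

text \<open>The extension of $\theta = x\partial$ to the whole differential field.\<close>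

definition euler :: "'k::field zlaurent \<Rightarrow> 'k zlaurent" where
  "euler f = fls_X * zlaurent_deriv f"

lemma euler_add: "euler (f + g) = euler f + euler g"
  by (simp add: euler_def zlaurent_deriv_add distrib_left)

lemma euler_mult: "euler (f * g) = euler f * g + f * euler g"
  by (simp add: euler_def zlaurent_deriv_mult algebra_simps)

lemma euler_nth: "fls_nth (euler f) n = zfrac_deriv (fls_nth f n) + of_int n * fls_nth f n"
  by (simp add: euler_def zlaurent_deriv_nth fls_X_times_conv_shift)

lemma euler_0: "euler 0 = 0"
  by (intro fls_eqI) (simp add: euler_nth)

lemma euler_1: "euler 1 = 0"
  by (intro fls_eqI) (simp add: euler_nth)

lemma euler_uminus: "euler (- f) = - euler f"
  using euler_add[of f "- f"] by (simp add: euler_0 eq_neg_iff_add_eq_0 add.commute)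

lemma euler_diff: "euler (f - g) = euler f - euler g"
  using euler_add[of f "- g"] by (simp add: euler_uminus)

lemma euler_power_char:
  fixes f :: "'p::prime_card mod_ring zlaurent"
  shows "euler (f ^ CARD('p)) = 0"
proof -
  have "euler (f ^ n) = of_nat n * f ^ (n - 1) * euler f" for n
  proof (induction n)
    case 0
    show ?case by (simp add: euler_1)
  next
    case (Suc n)
    then show ?case by (cases n) (simp_all add: euler_mult algebra_simps)
  qed
  moreover have "(of_nat CARD('p) :: 'p mod_ring zlaurent) = embed_fps (of_nat CARD('p))"
    by (simp only: embed_fps_of_nat)
  moreover have "(of_nat CARD('p) :: 'p mod_ring zpoly fps) = 0"
    by (simp add: of_nat_eq_0_iff_char_dvd)
  ultimately show ?thesis by (simp add: embed_fps_0)
qed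

lemma euler_zconst: "euler (embed_fps (fps_zconst f)) = embed_fps (fps_zconst (theta f))"
  unfolding euler_def embed_fps_zconst zlaurent_deriv_embed_fls fls_deriv_fps_to_fls
  by (simp add: embed_fls_mult embed_fls_X fls_times_fps_to_fls)

definition zprod :: "nat \<Rightarrow> 'k::field zlaurent" where
  "zprod i = fls_const (to_fract (\<Prod>k=1..i. z k))"

lemma zprod_0: "zprod 0 = 1" by (simp add: zprod_def)

lemma zprod_Suc: "zprod (Suc i) = zprod i * embed_fps (fps_const (z (Suc i)))"
  by (simp add: zprod_def embed_fps_const fls_const_mult_const)

lemma zprod_nonzero: "zprod i \<noteq> 0"
proof -
  have "z k \<noteq> (0 :: 'a zpoly)" for k
    by (auto simp: z_def dest: arg_cong[of _ _ "\<lambda>f. Poly_Mapping.keys f"])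
  then show ?thesis by (simp add: zprod_def fls_const_nonzero)
qed

lemma euler_z: "euler (embed_fps (fps_const (z (Suc i)))) = 1 / zprod i"
  unfolding euler_def embed_fps_const
  by (subst zlaurent_deriv_z) (simp_all add: zprod_def)

lemma euler_tower_residual:
  fixes c :: "'p::prime_card mod_ring fps"
  assumes "theta c = 0"
  shows "euler (embed_fps (tower_residual c i)) = 0"
proof (cases i)
  case 0
  have "fps_zconst 0 = (0 :: 'p mod_ring zpoly fps)" by (intro fps_ext) (simp add: fps_zconst_def)
  then show ?thesis using assms by (simp add: 0 euler_zconst embed_fps_0)
next
  case (Suc j)
  have "embed_fps (tower_residual c i) = - (embed_fps (tower_log c j) ^ CARD('p))"
    unfolding Suc tower_residual_Suc
    using embed_fps_diff[of 0 "tower_log c j ^ CARD('p)"] by (simp add: embed_fps_power embed_fps_0)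
  then show ?thesis by (simp add: euler_uminus euler_power_char)
qed

text \<open>
  With $G = G_i$, $C = c_i$ and $Z = z_{i+1}$ the derivative of $G$ is that of
  $G - G^p = ZC$, and $C$ is a constant, so
  $\theta G = C/(z_1\cdots z_i) = (G - G^p)/(z_1\cdots z_{i+1})$. The factor $1 - G^{p-1}$ of
  this numerator cancels against the one in the derivative of \<open>char_p_exp\<close>, and the logarithmic
  derivative of the new factor is $G/(z_1\cdots z_{i+1})$. Splitting $G = ZC + G^p$
  exhibits it as a difference of consecutive residual terms.
\<close>

lemma euler_tower_factor:
  fixes c :: "'p::prime_card mod_ring fps"
  assumes theta: "theta c = 0" and c: "\<And>n. n < CARD('p) \<Longrightarrow> fps_nth c n = 0"
  shows "euler (embed_fps (tower_factor h c (Suc i))) =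
    (embed_fps (tower_residual c i) / zprod i - embed_fps (tower_residual c (Suc i)) / zprod (Suc i)) *
    embed_fps (tower_factor h c (Suc i))"
proof -
  let ?p = "CARD('p)"
  let ?Z = "embed_fps (fps_const (z (Suc i))) :: 'p mod_ring zlaurent"
  define G where "G = embed_fps (tower_log c i)"
  define C where "C = embed_fps (tower_residual c i)"
  define H where "H = embed_fps (tower_factor h c (Suc i))"
  have p1: "1 < ?p" using prime_card[where ?'a = 'p] prime_gt_1_nat by blast
  have H: "H = char_p_exp ?p G"
    by (simp add: H_def G_def embed_fps_char_p_exp)
  have C': "embed_fps (tower_residual c (Suc i)) = - (G ^ ?p)"
    unfolding tower_residual_Suc G_def
    using embed_fps_diff[of 0 "tower_log c i ^ ?p"] by (simp add: embed_fps_power embed_fps_0)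
  have G: "G - G ^ ?p = ?Z * C"
    unfolding G_def C_def
    by (simp only: tower_log_diff_power[OF c] flip: embed_fps_power embed_fps_diff embed_fps_mult)
  have "euler G = euler (G - G ^ ?p)" by (simp add: euler_diff euler_power_char)
  also have "\<dots> = C / zprod i"
    unfolding G euler_mult euler_z C_def euler_tower_residual[OF theta] by simp
  also have "\<dots> = (G - G ^ ?p) / zprod (Suc i)"
    unfolding G zprod_Suc using zprod_nonzero[of "Suc i", where ?'a = "'p mod_ring"]
    by (simp add: zprod_Suc)
  also have "\<dots> = (1 - G ^ (?p - 1)) * (G / zprod (Suc i))"
    using p1 power_Suc[of G "?p - 1"] by (simp add: algebra_simps diff_divide_distrib)
  finally have euler_G: "euler G = (1 - G ^ (?p - 1)) * (G / zprod (Suc i))" .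
  have "(1 - G ^ (?p - 1)) * euler H = H * euler G"
    unfolding H
  proof (rule char_p_exp_derivation[OF euler_add euler_mult prime_card])
    have "(of_nat ?p :: 'p mod_ring zlaurent) = embed_fps (of_nat ?p)"
      by (simp only: embed_fps_of_nat)
    also have "(of_nat ?p :: 'p mod_ring zpoly fps) = 0"
      by (simp add: of_nat_eq_0_iff_char_dvd)
    finally show "(of_nat ?p :: 'p mod_ring zlaurent) = 0" by (simp add: embed_fps_0)
  qed
  also have "\<dots> = (1 - G ^ (?p - 1)) * (G / zprod (Suc i) * H)"
    unfolding euler_G by (simp only: mult_ac)
  finally have "(1 - G ^ (?p - 1)) * euler H = (1 - G ^ (?p - 1)) * (G / zprod (Suc i) * H)" .
  moreover have "1 - G ^ (?p - 1) \<noteq> 0"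
  proof -
    have "fps_nth (tower_log c i) 0 = 0"
      by (rule tower_residual_nth_eq_0(2)[OF c]) simp_all
    then have "fps_nth (1 - tower_log c i ^ (?p - 1)) 0 \<noteq> 0"
      using p1 by (simp add: fps_power_zeroth power_0_left)
    then have "1 - tower_log c i ^ (?p - 1) \<noteq> 0" by (metis fps_zero_nth)
    then have "embed_fps (1 - tower_log c i ^ (?p - 1)) \<noteq> embed_fps 0"
      by (simp only: embed_fps_eq_iff not_False_eq_True)
    then show ?thesis by (simp add: G_def embed_fps_diff embed_fps_1 embed_fps_power embed_fps_0)
  qed
  ultimately have "euler H = G / zprod (Suc i) * H" by (metis mult_cancel_left)
  also have "G / zprod (Suc i) = C / zprod i - (- (G ^ ?p)) / zprod (Suc i)"
  proof -
    have "G / zprod (Suc i) = ?Z * C / zprod (Suc i) + G ^ ?p / zprod (Suc i)"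
      unfolding G[symmetric] by (simp flip: add_divide_distrib)
    also have "?Z * C / zprod (Suc i) = C / zprod i"
      using zprod_nonzero[of "Suc i", where ?'a = "'p mod_ring"] by (simp add: zprod_Suc)
    finally show ?thesis by simp
  qed
  finally show ?thesis unfolding H_def C_def C' .
qed

text \<open>The differences in \<open>euler_tower_factor\<close> telescope, leaving only the last residual term.\<close>

lemma euler_tower_prod:
  fixes c :: "'p::prime_card mod_ring fps"
  assumes h: "theta h = (\<alpha> - c) * h" and theta: "theta c = 0"
    and c: "\<And>n. n < CARD('p) \<Longrightarrow> fps_nth c n = 0"
  defines "Y \<equiv> \<lambda>n. embed_fps (\<Prod>i\<le>n. tower_factor h c i)"
  shows "euler (Y n) =
    (embed_fps (fps_zconst \<alpha>) - embed_fps (tower_residual c n) / zprod n) * Y n"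
proof (induction n)
  case 0
  have "embed_fps (fps_zconst ((\<alpha> - c) * h)) =
      (embed_fps (fps_zconst \<alpha>) - embed_fps (fps_zconst c)) * embed_fps (fps_zconst h)"
    unfolding embed_fps_zconst by (simp add: embed_fls_mult embed_fls_diff fls_times_fps_to_fls)
  then show ?case by (simp add: Y_def euler_zconst h zprod_0)
next
  case (Suc n)
  have Y: "Y (Suc n) = Y n * embed_fps (tower_factor h c (Suc n))"
    unfolding Y_def by (simp only: prod.atMost_Suc embed_fps_mult)
  have F: "euler (embed_fps (tower_factor h c (Suc n))) =
      (embed_fps (tower_residual c n) / zprod n - embed_fps (tower_residual c (Suc n)) / zprod (Suc n)) *
      embed_fps (tower_factor h c (Suc n))"
    by (rule euler_tower_factor[OF theta c])
  show ?case
    unfolding Y euler_mult Suc F by (simp only: algebra_simps)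
qed

section \<open>The infinite product\<close>

lemma stable_coefficients:
  fixes h c :: "'p::prime_card mod_ring fps"
  assumes h: "fps_nth h 0 = 1" and c: "\<And>n. n < CARD('p) \<Longrightarrow> fps_nth c n = 0"
    and "m \<le> n"
  shows "fps_nth (\<Prod>i\<le>n. tower_factor h c i) m = fps_nth (\<Prod>i\<le>m. tower_factor h c i) m"
  using assms(3)
proof (induction n rule: dec_induct)
  case (step n)
  let ?P = "\<Prod>i\<le>n. tower_factor h c i"
  obtain g where g: "tower_factor h c (Suc n) = 1 + fps_X ^ (CARD('p) ^ Suc n) * fps_const (z (Suc n)) * g"
    using tower_factor_form[OF h c] by blast
  have "1 < CARD('p)" using prime_card[where ?'a = 'p] prime_gt_1_nat by blast
  then have lt: "m < CARD('p) ^ Suc n"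
    using step(1) power_gt_expt[of "CARD('p)" "Suc n"] by linarith
  have "?P * tower_factor h c (Suc n) =
      ?P + fps_X ^ (CARD('p) ^ Suc n) * (fps_const (z (Suc n)) * g * ?P)"
    unfolding g by (simp add: algebra_simps)
  then have "fps_nth (\<Prod>i\<le>Suc n. tower_factor h c i) m = fps_nth ?P m"
    using lt by (simp add: fps_X_power_mult_nth del: power_Suc tower_factor.simps)
  with step show ?case by simp
qed simp

text \<open>
  The $j$-th factor involves only $z_1, \ldots, z_j$ and is $1$ plus a multiple of $z_j$.
\<close>

lemma zproj_tower_factor:
  fixes h c :: "'p::prime_card mod_ring fps"
  assumes h: "fps_nth h 0 = 1" and c: "\<And>n. n < CARD('p) \<Longrightarrow> fps_nth c n = 0"
  shows "zproj i (tower_factor h c j) = (if j \<le> i then tower_factor h c j else 1)"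
proof -
  obtain g where g: "g \<in> zseries_upto j"
    and eq: "tower_factor h c j = 1 + fps_X ^ (CARD('p) ^ j) * fps_const (z j) * g"
    using tower_factor_form[OF h c] unfolding zseries_upto_def by blast
  show ?thesis
  proof (cases "j \<le> i")
    case True
    have "tower_factor h c j \<in> zseries_upto j"
      unfolding eq using zseries_upto_of_nat[of 1 j] z_in_zpolys_upto[of j j]
      by (intro zseries_upto_add zseries_upto_mult zseries_upto_power zseries_upto_X
            zseries_upto_const g) simp_all
    then have "tower_factor h c j \<in> zseries_upto i"
      using zseries_upto_mono[OF True] by blast
    then have pos: "zpositions (fps_nth (tower_factor h c j) n) \<subseteq> {..<i}" for n
      by (simp add: zseries_upto_def zpolys_upto_def)
    have "zproj i (tower_factor h c j) = tower_factor h c j"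
    proof (rule fps_ext)
      fix n
      show "fps_nth (zproj i (tower_factor h c j)) n = fps_nth (tower_factor h c j) n"
        unfolding zproj_def fps_nth_Abs_fps using pos[of n] by (intro zsubst_ident) auto
    qed
    with True show ?thesis by simp
  next
    case False
    then have "zproj i (fps_const (z j)) = (0 :: 'p mod_ring zpoly fps)"
      by (intro fps_ext) (simp add: zproj_def zsubst_z)
    then have "zproj i (tower_factor h c j) = 1"
      unfolding eq zproj_add zproj_mult zproj_1 by simp
    with False show ?thesis by simp
  qed
qed

theorem theorem1p3:
  fixes a :: "'p::prime_card mod_ring fls"
  assumes "algebraic_over rat_funs a"
    and "regular_at_0 a"
    and "local_exponent a = 0"
  shows "\<exists>y :: 'p mod_ring zpoly fps.
    y \<noteq> 0 \<and>
    zlaurent_deriv (embed_fps y) = embed_fls a * embed_fps y \<and>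
    (\<forall>i\<ge>1. algebraic_over (zrat_funs i) (embed_fps (zproj i y))) \<and>
    (\<exists>h :: nat \<Rightarrow> 'p mod_ring zpoly fps.
      (\<lambda>n. \<Prod>i\<le>n. h i) \<longlonglongrightarrow> y \<and>
      (\<forall>i. (\<exists>g. (\<forall>n. fps_nth g n \<in> zpolys_upto i) \<and>
              h i = 1 + fps_X ^ (CARD('p) ^ i) * fps_const (z i) * g) \<and>
           algebraic_over (zrat_funs i) (embed_fps (h i))))"
proof -
  have p1: "1 < CARD('p)" using prime_card[where ?'a = 'p] prime_gt_1_nat by blast
  define \<alpha> where "\<alpha> = fps_X * fls_regpart a"
  have a: "a = fps_to_fls (fls_regpart a)"
  proof (rule fls_eqI)
    fix n :: int
    have "fls_nth a n = 0" if "n < 0"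
    proof (cases "n = -1")
      case True
      then show ?thesis using assms(3) by (simp add: local_exponent_def)
    next
      case False
      with that assms(2) show ?thesis
        by (intro fls_eq0_below_subdegree) (simp add: regular_at_0_def)
    qed
    then show "fls_nth a n = fls_nth (fps_to_fls (fls_regpart a)) n" by simp
  qed
  have \<alpha>: "fps_to_fls \<alpha> = fls_X * a"
    by (subst a) (simp add: \<alpha>_def fls_times_fps_to_fls)
  have "algebraic_over rat_funs (fps_to_fls \<alpha>)"
    unfolding \<alpha>
    using is_subfield_mult[OF is_subfield_algebraic_over[OF is_subfield_rat_funs]] assms(1)
      algebraic_over_self[OF is_subfield_rat_funs fls_X_in_rat_funs] by blast
  moreover have "fps_nth \<alpha> 0 = 0" by (simp add: \<alpha>_def)
  ultimately obtain h c where h0: "fps_nth h 0 = 1" and h: "theta h = (\<alpha> - c) * h"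
    and theta_c: "theta c = 0" and c0: "fps_nth c 0 = 0"
    and alg: "algebraic_over rat_funs (fps_to_fls h)" "algebraic_over rat_funs (fps_to_fls c)"
    using exists_algebraic_solution_up_to_p_powers by metis
  have c: "fps_nth c n = 0" if "n < CARD('p)" for n
  proof (cases "n = 0")
    case False
    then have "\<not> CARD('p) dvd n" using that by (auto dest: dvd_imp_le)
    then show ?thesis
      using theta_nth[of c n] of_nat_mod_ring_eq_0_iff[of n, where ?'p = 'p] unfolding theta_c by simp
  qed (simp add: c0)
  let ?h = "tower_factor h c"
  define Y where "Y n = (\<Prod>i\<le>n. ?h i)" for n
  define y where "y = Abs_fps (\<lambda>n. fps_nth (Y n) n)"
  have y_nth: "fps_nth y m = fps_nth (Y n) m" if "m \<le> n" for m n
    using stable_coefficients[OF h0 c that] by (simp add: y_def Y_def)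
  have lim: "Y \<longlonglongrightarrow> y"
  proof (rule tendsto_fpsI)
    fix m
    show "\<forall>\<^sub>F n in sequentially. fps_nth (Y n) m = fps_nth y m"
      using eventually_ge_at_top[of m] by eventually_elim (simp add: y_nth)
  qed
  have "fps_nth y 0 = 1"
    by (simp add: y_def Y_def fps_zconst_def h0)
  then have "y \<noteq> 0" by auto
  moreover have "zlaurent_deriv (embed_fps y) = embed_fls a * embed_fps y"
  proof -
    \<comment> \<open>The coefficient of $x^n$ on either side depends on \<open>y\<close> modulo $x^{n+1}$ only, so \<open>y\<close> may be
      replaced by the partial product \<open>Y n\<close>, whose residual term vanishes modulo $x^{n+1}$.\<close>
    have "euler (embed_fps y) = embed_fps (fps_zconst \<alpha>) * embed_fps y"
    proof (rule fls_eqI)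
      fix n :: int
      show "fls_nth (euler (embed_fps y)) n = fls_nth (embed_fps (fps_zconst \<alpha>) * embed_fps y) n"
      proof (cases "n < 0")
        case True
        then show ?thesis by (simp add: euler_nth embed_fps_nth flip: embed_fps_mult)
      next
        case False
        define N where "N = nat n"
        let ?r = "tower_residual c N"
        have "CARD('p) ^ Suc N > N" using power_gt_expt[of "CARD('p)" "Suc N"] p1 by linarith
        have "fps_nth (?r * Y N) N = 0"
          unfolding fps_mult_nth
        proof (rule sum.neutral, rule ballI)
          fix k assume "k \<in> {0..N}"
          then have "fps_nth ?r k = 0"
            using \<open>CARD('p) ^ Suc N > N\<close> by (intro tower_residual_nth_eq_0(1)[OF c]) simp_all
          then show "fps_nth ?r k * fps_nth (Y N) (N - k) = 0" by simp
        qed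
        then have r: "fls_nth (embed_fps (?r * Y N)) n = 0"
          using False by (simp add: embed_fps_nth N_def)
        have inv: "1 / zprod N = fls_const (1 / to_fract (\<Prod>k=1..N. z k :: 'p mod_ring zpoly))"
          by (simp add: zprod_def divide_inverse fls_inverse_const)
        have "fls_nth (embed_fps y) n = fls_nth (embed_fps (Y N)) n"
          using False y_nth[of N N] by (simp add: embed_fps_nth N_def)
        then have "fls_nth (euler (embed_fps y)) n = fls_nth (euler (embed_fps (Y N))) n"
          by (simp add: euler_nth)
        also have "euler (embed_fps (Y N)) =
            embed_fps (fps_zconst \<alpha> * Y N) - (1 / zprod N) * embed_fps (?r * Y N)"
          using euler_tower_prod[OF h theta_c c, of N]
          unfolding Y_def[symmetric] by (simp add: algebra_simps embed_fps_mult)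
        also have "fls_nth \<dots> n = fls_nth (embed_fps (fps_zconst \<alpha> * Y N)) n"
          unfolding inv by (simp add: r)
        also have "\<dots> = fls_nth (embed_fps (fps_zconst \<alpha> * y)) n"
        proof -
          have "fps_nth (fps_zconst \<alpha> * Y N) N = fps_nth (fps_zconst \<alpha> * y) N"
            unfolding fps_mult_nth by (intro sum.cong refl) (simp add: y_nth[of _ N])
          then show ?thesis using False by (simp add: embed_fps_nth N_def)
        qed
        finally show ?thesis by (simp add: embed_fps_mult)
      qed
    qed
    then have "fls_X * zlaurent_deriv (embed_fps y) = fls_X * (embed_fls a * embed_fps y)"
      by (simp add: euler_def embed_fps_zconst \<alpha> embed_fls_mult embed_fls_X mult.assoc)
    then show ?thesis by simp
  qed
  moreover have "algebraic_over (zrat_funs i) (embed_fps (zproj i y))" for i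
  proof -
    have "zproj i y = Y i"
    proof (rule fps_ext)
      fix n
      let ?N = "max n i"
      have "fps_nth (zproj i y) n = fps_nth (zproj i (Y ?N)) n"
        using y_nth[of n ?N] by (simp add: zproj_def)
      also have "zproj i (Y ?N) = (\<Prod>j\<le>?N. if j \<le> i then ?h j else 1)"
        unfolding Y_def zproj_prod by (intro prod.cong refl zproj_tower_factor[OF h0 c])
      also have "\<dots> = Y i"
        unfolding Y_def by (rule prod.mono_neutral_cong_right) auto
      finally show "fps_nth (zproj i y) n = fps_nth (Y i) n" .
    qed
    moreover have "embed_fps (Y i) \<in> {f. algebraic_over (zrat_funs i) f}"
      unfolding Y_def embed_fps_prod
    proof (rule is_subfield_prod[OF is_subfield_algebraic_over[OF is_subfield_zrat_funs]])
      fix j assume "j \<in> {..i}"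
      then show "embed_fps (?h j) \<in> {f. algebraic_over (zrat_funs i) f}"
        using algebraic_over_mono[OF tower_factor_algebraic[OF c alg] zrat_funs_mono] by simp
    qed
    ultimately show ?thesis by simp
  qed
  moreover have "(\<lambda>n. \<Prod>i\<le>n. ?h i) \<longlonglongrightarrow> y" using lim by (simp add: Y_def[abs_def])
  ultimately show ?thesis
    using tower_factor_form[OF h0 c] tower_factor_algebraic[OF c alg] by blast
qed

end
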